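(* Let $n$ be a positive integer, let $\rho \in [0,1]$, and let $k$ be the number such that $\frac{n}{k} - 1 = (1-\rho)(n-1)$. Let $t(n,\rho) = \binom{n}{3} - \frac{n(n-1)(1-\rho)}{6}\big((1+2\rho)n - 2 - 2\rho\big)$. Consider the following system of polynomial equations over $\mathbb{R}$ in the variables $\{x_{ij} : 1 \le i<j \le n\}$ (with $x_{ji} = x_{ij}$): (1) $x_{ij}^2 - x_{ij} = 0$ for all $1 \le i<j \le n$; (2) $\sum_{1 \le i<j \le n} x_{ij} - \rho\binom{n}{2} = 0$; (3) $\sum_{1 \le i<j<k' \le n} x_{ij}x_{ik'}x_{jk'} - t(n,\rho) = 0$. Then degree $\lfloor \min\{k, \frac{n}{k}\}\rfloor + 1$ SOS fails to refute this system; that is, with $d = \lfloor \min\{k, \frac{n}{k}\}\rfloor + 1$, there is no identity $-1 = \sum_i f_i s_i + \sum_j g_j^2$, where the $s_i$ range over the left-hand sides of the equations above and $f_i,g_j$ are real polynomials, with $\deg(f_i)+\deg(s_i) \le d$ and $\deg(g_j) \le d/2$.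
   Context: The variables encode a graph $G$ on vertex set $[1,n]$ ($x_{ij}=1$ iff $\{i,j\}$ is an edge); the equations say $G$ has edge density $\rho$ and exactly $t(n,\rho)$ triangles, where $t(n,\rho)$ is Goodman's lower bound on the number of triangles. Degree refers to ordinary total polynomial degree.
   Formalization: The case n = 2 with 0 < ρ < 1 is excluded, because there d = 2 and the identity (x²−x) − (x+ρ−1)(x−ρ) = −ρ(1−ρ) < 0 in the single variable x gives a degree 2 refutation, so the claim is false exactly there. *)

theory Defs
  imports Complex_Main "HOL-Library.Poly_Mapping" "HOL-Library.Extended_Real"
begin

text \<open>
  Real polynomials in commuting variables of type \<open>'v\<close>: a monomial is a finitely supported exponent
  vector, a polynomial a finitely supported coefficient function on monomials, with the convolution
  product of \<open>HOL-Library.Poly_Mapping\<close>.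
\<close>

type_synonym 'v rpoly = "('v \<Rightarrow>\<^sub>0 nat) \<Rightarrow>\<^sub>0 real"

definition const_poly :: "real \<Rightarrow> 'v rpoly" where
  "const_poly c = Poly_Mapping.single 0 c"

definition var_poly :: "'v \<Rightarrow> 'v rpoly" where
  "var_poly v = Poly_Mapping.single (Poly_Mapping.single v 1) 1"

definition poly_vars :: "'v rpoly \<Rightarrow> 'v set" where
  "poly_vars p = (\<Union>m\<in>Poly_Mapping.keys p. Poly_Mapping.keys m)"

definition mono_degree :: "('v \<Rightarrow>\<^sub>0 nat) \<Rightarrow> nat" where
  "mono_degree m = (\<Sum>v\<in>Poly_Mapping.keys m. Poly_Mapping.lookup m v)"

text \<open>
  The degree of the zero polynomial is \<open>-\<infinity>\<close>, so that an equation whose degree exceeds the bound may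
  still be given the coefficient 0 in an SOS refutation.
\<close>

definition total_degree :: "'v rpoly \<Rightarrow> ereal" where
  "total_degree p = (SUP m\<in>Poly_Mapping.keys p. ereal (real (mono_degree m)))"

text \<open>
  Degree \<open>d\<close> SOS refutes the system \<open>{s = 0 | s \<in> S}\<close> over the variables \<open>V\<close>. The list \<open>fs\<close> consists
  of pairs of a coefficient polynomial and a left-hand side from \<open>S\<close>.
\<close>

definition sos_refutes :: "nat \<Rightarrow> 'v set \<Rightarrow> 'v rpoly set \<Rightarrow> bool" where
  "sos_refutes d V S \<longleftrightarrow>
    (\<exists>fs gs.
      (\<forall>(f, s)\<in>set fs. s \<in> S \<and> poly_vars f \<subseteq> V \<and>
          total_degree f + total_degree s \<le> ereal (real d)) \<and>
      (\<forall>g\<in>set gs. poly_vars g \<subseteq> V \<and> total_degree g \<le> ereal (real d / 2)) \<and>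
      - 1 = (\<Sum>(f, s)\<leftarrow>fs. f * s) + (\<Sum>g\<leftarrow>gs. g\<^sup>2))"

definition edge_index :: "nat \<Rightarrow> (nat \<times> nat) set" where
  "edge_index n = {(i, j). 1 \<le> i \<and> i < j \<and> j \<le> n}"

definition triangle_index :: "nat \<Rightarrow> (nat \<times> nat \<times> nat) set" where
  "triangle_index n = {(i, j, l). 1 \<le> i \<and> i < j \<and> j < l \<and> l \<le> n}"

definition edge_var :: "nat \<Rightarrow> nat \<Rightarrow> (nat \<times> nat) rpoly" where
  "edge_var i j = var_poly (min i j, max i j)"

definition goodman_bound :: "nat \<Rightarrow> real \<Rightarrow> real" where
  "goodman_bound n \<rho> =
    real (n choose 3)
      - real n * (real n - 1) * (1 - \<rho>) / 6 * ((1 + 2 * \<rho>) * real n - 2 - 2 * \<rho>)"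

definition goodman_system :: "nat \<Rightarrow> real \<Rightarrow> (nat \<times> nat) rpoly set" where
  "goodman_system n \<rho> =
    {(edge_var i j)\<^sup>2 - edge_var i j | i j. (i, j) \<in> edge_index n}
    \<union> {(\<Sum>(i, j)\<in>edge_index n. edge_var i j) - const_poly (\<rho> * real (n choose 2))}
    \<union> {(\<Sum>(i, j, l)\<in>triangle_index n. edge_var i j * edge_var i l * edge_var j l)
         - const_poly (goodman_bound n \<rho>)}"

text \<open>
  For \<open>n = 2\<close> and \<open>0 < \<rho> < 1\<close> the system contains \<open>x\<^sup>2 - x\<close> and \<open>x - \<rho>\<close> for a single variable \<open>x\<close>, and
  \<open>(x\<^sup>2 - x) - (x + \<rho> - 1) (x - \<rho>) = - \<rho> (1 - \<rho>)\<close> is a refutation of degree 2. Here \<open>n / k = 2 - \<rho>\<close>, so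
  degree 2 is exactly the degree \<open>\<lfloor>min {k, n / k}\<rfloor> + 1\<close>: non-refutability fails in this case.
\<close>

lemma total_degree_le:
  assumes "\<And>m. m \<in> Poly_Mapping.keys p \<Longrightarrow> real (mono_degree m) \<le> b"
  shows "total_degree p \<le> ereal b"
  unfolding total_degree_def using assms by (intro SUP_least) simp

lemma sos_refutes_single_edge:
  assumes rho: "0 < \<rho>" "\<rho> < 1" and k: "real 2 / k - 1 = (1 - \<rho>) * (real 2 - 1)"
  shows "sos_refutes (nat \<lfloor>min k (real 2 / k)\<rfloor> + 1) (edge_index 2) (goodman_system 2 \<rho>)"
proof -
  have nk: "2 / k = 2 - \<rho>" using k by simp
  have "k \<noteq> 0" using nk rho by auto
  then have k_eq: "k = 2 / (2 - \<rho>)" using nk rho by (simp add: field_simps)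
  have "1 \<le> k" "k < 2" unfolding k_eq using rho by (auto simp: field_simps)
  then have "\<lfloor>min k (real 2 / k)\<rfloor> = 1"
    using nk rho by (intro floor_unique) (auto simp: min_def)
  then have d: "nat \<lfloor>min k (real 2 / k)\<rfloor> + 1 = 2" by simp

  define x where "x = edge_var 1 2"
  define e where "e = (Poly_Mapping.single (1, 2) 1 :: (nat \<times> nat) \<Rightarrow>\<^sub>0 nat)"
  define c where "c = 1 / (\<rho> * (1 - \<rho>))"
  have x: "x = Poly_Mapping.single e 1"
    by (simp add: x_def e_def edge_var_def var_poly_def numeral_2_eq_2)
  have x2: "x\<^sup>2 = Poly_Mapping.single (e + e) 1"
    by (simp add: x power2_eq_square mult_single)
  have deg: "mono_degree 0 = 0" "mono_degree e = 1" "mono_degree (e + e) = 2"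
    by (simp_all add: mono_degree_def e_def flip: single_add)
  have ei: "edge_index 2 = {(1, 2)}" by (auto simp: edge_index_def)
  have S1: "x\<^sup>2 - x \<in> goodman_system 2 \<rho>"
    unfolding goodman_system_def ei x_def by blast
  have S2: "x - const_poly \<rho> \<in> goodman_system 2 \<rho>"
    unfolding goodman_system_def ei x_def by simp
  let ?f1 = "const_poly c :: (nat \<times> nat) rpoly"
  let ?f2 = "Poly_Mapping.single e (- c) + const_poly (c * (1 - \<rho>))"
  have ks1: "Poly_Mapping.keys (x\<^sup>2 - x) \<subseteq> {e + e, e}"
    unfolding x2 unfolding x by (rule order_trans[OF keys_diff]) auto
  have ks2: "Poly_Mapping.keys (x - const_poly \<rho>) \<subseteq> {e, 0}"
    unfolding x const_poly_def by (rule order_trans[OF keys_diff]) auto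
  have kf1: "Poly_Mapping.keys ?f1 \<subseteq> {0}" by (simp add: const_poly_def)
  have kf2: "Poly_Mapping.keys ?f2 \<subseteq> {e, 0}"
    unfolding const_poly_def by (rule order_trans[OF keys_add]) auto
  have dg: "total_degree (x\<^sup>2 - x) \<le> ereal 2" "total_degree (x - const_poly \<rho>) \<le> ereal 1"
    "total_degree ?f1 \<le> ereal 0" "total_degree ?f2 \<le> ereal 1"
    by (auto intro!: total_degree_le
      dest!: subsetD[OF ks1] subsetD[OF ks2] subsetD[OF kf1] subsetD[OF kf2] simp: deg)
  have sums: "total_degree ?f1 + total_degree (x\<^sup>2 - x) \<le> ereal (real 2)"
    "total_degree ?f2 + total_degree (x - const_poly \<rho>) \<le> ereal (real 2)"
    using add_mono[OF dg(3,1)] add_mono[OF dg(4,2)] by simp_all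
  have ke: "Poly_Mapping.keys e \<subseteq> edge_index 2" by (simp add: e_def ei)
  have vars: "poly_vars ?f1 \<subseteq> edge_index 2" "poly_vars ?f2 \<subseteq> edge_index 2"
    using kf1 kf2 ke unfolding poly_vars_def by fastforce+
  have crho: "c * (\<rho> * (1 - \<rho>)) = 1" using rho by (simp add: c_def)
  have "?f1 * (x\<^sup>2 - x) + ?f2 * (x - const_poly \<rho>)
      = Poly_Mapping.single e (c * \<rho> + c * (1 - \<rho>) - c)
        + Poly_Mapping.single 0 (- (c * (\<rho> * (1 - \<rho>))))"
    unfolding x2 unfolding x const_poly_def
    by (simp add: algebra_simps mult_single single_add single_diff single_uminus)
  also have "\<dots> = - 1"
    unfolding crho by (simp add: algebra_simps single_uminus flip: single_one)
  finally have id: "?f1 * (x\<^sup>2 - x) + ?f2 * (x - const_poly \<rho>) = - 1" .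
  show ?thesis
    unfolding d sos_refutes_def
    by (rule exI[of _ "[(?f1, x\<^sup>2 - x), (?f2, x - const_poly \<rho>)]"], rule exI[of _ "[]"])
       (use S1 S2 vars sums id in simp)
qed

end

(*
  Put s = n / k. If k and s were integers, the complete multipartite graph with k parts of size s would
  have edge density rho and t(n, rho) triangles. The distribution of a uniformly random copy of this
  graph gives each partition of the vertices a weight that is a rational function of k and s, and this
  formula still defines a signed measure with consistent marginals for real k and s. Its expectation is
  the pseudo-expectation.

  Boolean equations hold pointwise, and the degree and triangle equations hold against functions of a
  few vertices, since the conditional expectation of a sum over the remaining vertices is exact. For
  positivity one may average the square root g over the permutations fixing some set I of at most d
  vertices: an almost minimal direction of the quadratic form has a large coordinate, which survives
  the averaging over the permutations that fix it. Such a symmetric g agrees with a function h of the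
  partition restricted to I, and the expectation of h^2 is nonnegative because the partitions of I
  have nonnegative weight for |I| <= floor(min(k, s)) + 1.

  Both arguments need 2 d <= n. Otherwise n <= 2 or n = 4 and k = s = 2 (a graph solving the system
  exists), or n = 3 (the knapsack pseudo-expectation works), or n = 5 and d = 3 (the degree 3
  moments need a correction).
*)
theory Submission
  imports Defs "HOL-Library.FuncSet" "HOL-Combinatorics.Permutations"
begin

section \<open>Signed measure on colourings\<close>

text \<open>For integers \<open>k\<close> and \<open>s\<close> the weight of a partition of
  \<open>J\<close> counts the injections of \<open>J\<close> into the vertices of the multipartite
  graph that induce it: assign distinct parts to the blocks, then distinct places within each part.
  Nothing is normalised by the number of injections, since a refutation is already contradicted by a
  functional that is positive at 1. For real \<open>k\<close> and \<open>s\<close> the weights on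
  large sets may be negative, so squares cannot be estimated pointwise on \<open>V\<close> and have
  to be brought down to few vertices. The exact conditional expectation eliminates a vertex only
  from a sum over all vertices outside \<open>J\<close>, not from a single term. Symmetrisation
  repairs this: once the vertices outside \<open>I\<close> are interchangeable, a single term is, up
  to a factor, that full sum minus the terms in which the vertex has been moved into
  \<open>I\<close>. The requirement \<open>2 * D \<le> card V\<close> has its origin here: a
  conditioning set of fewer than \<open>D\<close> vertices, together with the at most
  \<open>D\<close> vertices of a test function, must leave a vertex free.\<close>

definition falling :: "real \<Rightarrow> nat \<Rightarrow> real" where
  "falling x b = (\<Prod>i<b. x - real i)"

lemma falling_0 [simp]: "falling x 0 = 1"
  by (simp add: falling_def)

lemma falling_Suc: "falling x (Suc b) = falling x b * (x - real b)"
  by (simp add: falling_def)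

text \<open>The smallest factor is \<open>x - (b - 1)\<close>, so one more than \<open>x\<close> is
  allowed. This is the origin of the \<open>+ 1\<close> in the degree.\<close>

lemma falling_nonneg: "real b \<le> x + 1 \<Longrightarrow> 0 \<le> falling x b"
  unfolding falling_def by (intro prod_nonneg) auto

lemma falling_pos: "b \<le> m \<Longrightarrow> 0 < falling (real m) b"
  unfolding falling_def by (intro prod_pos) auto

definition depends_on :: "nat set \<Rightarrow> ((nat \<Rightarrow> nat) \<Rightarrow> real) \<Rightarrow> bool" where
  "depends_on J X \<longleftrightarrow> (\<forall>c c'. (\<forall>i\<in>J. c i = c' i) \<longrightarrow> X c = X c')"

definition pattern_local :: "nat set \<Rightarrow> ((nat \<Rightarrow> nat) \<Rightarrow> real) \<Rightarrow> bool" where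
  "pattern_local J X \<longleftrightarrow>
    (\<forall>c c'. (\<forall>i\<in>J. \<forall>j\<in>J. c i = c j \<longleftrightarrow> c' i = c' j) \<longrightarrow> X c = X c')"

lemma depends_onD: "depends_on J X \<Longrightarrow> (\<And>i. i \<in> J \<Longrightarrow> c i = c' i) \<Longrightarrow> X c = X c'"
  unfolding depends_on_def by blast

lemma pattern_localD:
  "pattern_local J X \<Longrightarrow> (\<And>i j. i \<in> J \<Longrightarrow> j \<in> J \<Longrightarrow> c i = c j \<longleftrightarrow> c' i = c' j) \<Longrightarrow> X c = X c'"
  unfolding pattern_local_def by blast

lemma pattern_local_imp_depends_on: "pattern_local J X \<Longrightarrow> depends_on J X"
  unfolding depends_on_def pattern_local_def by metis

lemma depends_on_mono: "depends_on J X \<Longrightarrow> J \<subseteq> K \<Longrightarrow> depends_on K X"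
  unfolding depends_on_def by blast

definition occ :: "nat set \<Rightarrow> (nat \<Rightarrow> nat) \<Rightarrow> nat \<Rightarrow> nat" where
  "occ J c a = card {v\<in>J. c v = a}"

lemma occ_insert:
  assumes "finite J" "v \<notin> J"
  shows "occ (insert v J) (c(v := a)) b = occ J c b + (if b = a then 1 else 0)"
proof -
  have "{u \<in> insert v J. (c(v := a)) u = b} = (if b = a then insert v {u\<in>J. c u = b} else {u\<in>J. c u = b})"
    using assms by auto
  then show ?thesis using assms by (simp add: occ_def)
qed

lemma occ_eq_0: "a \<notin> c ` J \<Longrightarrow> occ J c a = 0"
proof -
  assume "a \<notin> c ` J"
  then have "{v\<in>J. c v = a} = {}" by auto
  then show ?thesis by (simp only: occ_def card.empty)
qed

lemma sum_by_colour:
  fixes \<psi> :: "nat \<Rightarrow> real"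
  assumes "finite J" "finite A" "c ` J \<subseteq> A"
  shows "(\<Sum>v\<in>J. \<psi> (c v)) = (\<Sum>a\<in>A. real (occ J c a) * \<psi> a)"
proof -
  have "(\<Sum>v\<in>J. \<psi> (c v)) = (\<Sum>a\<in>A. \<Sum>v\<in>{v\<in>J. c v = a}. \<psi> (c v))"
    using assms by (intro sum.group[symmetric]) auto
  also have "\<dots> = (\<Sum>a\<in>A. real (occ J c a) * \<psi> a)"
    by (intro sum.cong) (auto simp: occ_def)
  finally show ?thesis .
qed

locale fractional_partition =
  fixes V :: "nat set" and s k :: real
  assumes finV: "finite V" and sk: "s * k = real (card V)"
begin

text \<open>
  Partitions are encoded as colourings, with the vertices as colours. The last factor of the weight
  divides by the number of injective namings of the colour classes, so that each partition has the total weight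
  \<open>k (k - 1) \<cdots> (k - r + 1) \<cdot> \<Prod>\<^sub>i s (s - 1) \<cdots> (s - b\<^sub>i + 1)\<close> for \<open>r\<close> blocks of sizes \<open>b\<^sub>i\<close>.
\<close>

definition weight :: "nat set \<Rightarrow> (nat \<Rightarrow> nat) \<Rightarrow> real" where
  "weight J c = (\<Prod>a\<in>V. falling s (occ J c a)) *
     (falling k (card (c ` J)) / falling (real (card V)) (card (c ` J)))"

text \<open>
  The factor by which the weight changes when a new vertex receives the colour \<open>a\<close>. It is \<open>card V - card J\<close>
  times a conditional probability, but is defined also where the weight of \<open>c\<close> vanishes.
\<close>

definition trans_weight :: "nat set \<Rightarrow> (nat \<Rightarrow> nat) \<Rightarrow> nat \<Rightarrow> real" where
  "trans_weight J c a =
    (if a \<in> c ` J then s - real (occ J c a)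
     else s * (k - real (card (c ` J))) / (real (card V) - real (card (c ` J))))"

text \<open>For \<open>J \<subseteq> V\<close> and \<open>n = card V\<close> the total mass is
  \<open>n (n - 1) \<cdots> (n - card J + 1)\<close>, not 1.\<close>

definition expect :: "nat set \<Rightarrow> ((nat \<Rightarrow> nat) \<Rightarrow> real) \<Rightarrow> real" where
  "expect J X = (\<Sum>c\<in>PiE J (\<lambda>_. V). weight J c * X c)"

lemma weight_insert:
  assumes "J \<subseteq> V" "v \<notin> J" "a \<in> V"
  shows "weight (insert v J) (c(v := a)) = weight J c * trans_weight J c a"
proof -
  have fin: "finite J" using assms(1) finV finite_subset by blast
  have im: "(c(v := a)) ` insert v J = insert a (c ` J)"
    using assms by auto
  have 1: "(\<Prod>b\<in>V. falling s (occ (insert v J) (c(v := a)) b))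
      = (\<Prod>b\<in>V. falling s (occ J c b)) * (s - real (occ J c a))"
  proof -
    have "(\<Prod>b\<in>V - {a}. falling s (occ (insert v J) (c(v := a)) b)) = (\<Prod>b\<in>V - {a}. falling s (occ J c b))"
      by (intro prod.cong) (auto simp: occ_insert[OF fin assms(2)])
    then show ?thesis using finV assms(3)
      by (simp add: prod.remove[of V a] occ_insert[OF fin assms(2)] falling_Suc)
  qed
  show ?thesis
  proof (cases "a \<in> c ` J")
    case True
    then have "insert a (c ` J) = c ` J" by auto
    then show ?thesis unfolding weight_def im 1 using True by (simp add: trans_weight_def)
  next
    case False
    then have "card (insert a (c ` J)) = Suc (card (c ` J))" using fin by simp
    then show ?thesis unfolding weight_def im 1 using False
      by (simp add: trans_weight_def falling_Suc occ_eq_0)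
  qed
qed

lemma expect_insert:
  assumes "J \<subseteq> V" "v \<notin> J"
  shows "expect (insert v J) X
    = (\<Sum>c\<in>PiE J (\<lambda>_. V). weight J c * (\<Sum>a\<in>V. trans_weight J c a * X (c(v := a))))"
proof -
  have inj: "inj_on (\<lambda>(y, g). g(v := y)) (V \<times> PiE J (\<lambda>_. V))"
    using inj_combinator[OF assms(2), of "\<lambda>_. V"] by simp
  have "expect (insert v J) X
      = (\<Sum>(a, c)\<in>V \<times> PiE J (\<lambda>_. V). weight (insert v J) (c(v := a)) * X (c(v := a)))"
    unfolding expect_def PiE_insert_eq
    by (subst sum.reindex[OF inj]) (auto intro!: sum.cong)
  also have "\<dots> = (\<Sum>(a, c)\<in>V \<times> PiE J (\<lambda>_. V). weight J c * (trans_weight J c a * X (c(v := a))))"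
    using weight_insert[OF assms] by (intro sum.cong) (auto simp: mult.assoc)
  also have "\<dots> = (\<Sum>c\<in>PiE J (\<lambda>_. V). \<Sum>a\<in>V. weight J c * (trans_weight J c a * X (c(v := a))))"
    by (subst sum.cartesian_product[symmetric], subst sum.swap) simp
  finally show ?thesis by (simp add: sum_distrib_left)
qed

lemma sum_trans_weight_split:
  assumes "J \<subseteq> V" "c ` J \<subseteq> V"
  shows "(\<Sum>a\<in>V. trans_weight J c a * \<psi> a) = (\<Sum>a\<in>c ` J. (s - real (occ J c a)) * \<psi> a)
     + s * (k - real (card (c ` J))) / (real (card V) - real (card (c ` J))) * (\<Sum>a\<in>V - c ` J. \<psi> a)"
proof -
  have "(\<Sum>a\<in>V. trans_weight J c a * \<psi> a)
      = (\<Sum>a\<in>V - c ` J. trans_weight J c a * \<psi> a) + (\<Sum>a\<in>c ` J. trans_weight J c a * \<psi> a)"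
    using assms finV by (intro sum.subset_diff) auto
  then show ?thesis by (simp add: trans_weight_def sum_distrib_left)
qed

lemma card_image_less:
  assumes "J \<subseteq> V" "card J < card V"
  shows "card (c ` J) < card V"
  using assms card_image_le[of J c] finite_subset[OF _ finV, of J] by simp

text \<open>If \<open>r\<close> colours occur on \<open>J\<close>, they contribute
  \<open>s * r - card J\<close> and the new colours \<open>s * (k - r)\<close>. The assumption
  \<open>s * k = card V\<close> thus makes the marginals consistent; \<open>card J < card V\<close>
  keeps the denominator \<open>card V - r\<close> nonzero.\<close>

lemma sum_trans_weight:
  assumes "J \<subseteq> V" "card J < card V" "c ` J \<subseteq> V"
  shows "(\<Sum>a\<in>V. trans_weight J c a) = real (card V) - real (card J)"
proof -
  have fin: "finite J" using assms(1) finV finite_subset by blast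
  have "(\<Sum>a\<in>c ` J. real (occ J c a)) = real (card J)"
    using sum_by_colour[of J "c ` J" c "\<lambda>_. 1"] fin by simp
  moreover have "card (V - c ` J) = card V - card (c ` J)"
    using assms fin by (simp add: card_Diff_subset)
  moreover have "card (c ` J) < card V" by (rule card_image_less[OF assms(1,2)])
  ultimately have "(\<Sum>a\<in>V. trans_weight J c a) = s * real (card (c ` J)) - real (card J)
      + s * (k - real (card (c ` J)))"
    using sum_trans_weight_split[OF assms(1,3), of "\<lambda>_. 1"]
    by (simp add: sum_subtractf of_nat_diff mult.commute)
  then show ?thesis using sk by (simp add: algebra_simps)
qed

lemma expect_insert_marginal:
  assumes "J \<subseteq> V" "v \<in> V - J" "depends_on J X"
  shows "expect (insert v J) X = (real (card V) - real (card J)) * expect J X"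
proof -
  have "card J < card V"
    using assms finV by (intro psubset_card_mono) auto
  have X: "X (c(v := a)) = X c" for c a
    using assms(2) by (intro depends_onD[OF assms(3)]) auto
  have "expect (insert v J) X
      = (\<Sum>c\<in>PiE J (\<lambda>_. V). weight J c * (\<Sum>a\<in>V. trans_weight J c a * X (c(v := a))))"
    using assms by (intro expect_insert) auto
  also have "\<dots> = (\<Sum>c\<in>PiE J (\<lambda>_. V). weight J c * ((real (card V) - real (card J)) * X c))"
    using sum_trans_weight[OF assms(1) \<open>card J < card V\<close>]
    by (intro sum.cong) (auto simp: X PiE_iff image_subset_iff simp flip: sum_distrib_right)
  finally show ?thesis by (simp add: expect_def sum_distrib_left mult_ac)
qed

lemma expect_marginal:
  assumes "J \<subseteq> V" "depends_on J X"
  shows "expect V X = fact (card V - card J) * expect J X"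
  using assms
proof (induction "card V - card J" arbitrary: J)
  case 0
  then have "J = V" using card_mono[OF finV, of J] by (intro card_subset_eq[OF finV]) auto
  then show ?case by simp
next
  case (Suc m)
  then have "J \<noteq> V" by auto
  then obtain v where v: "v \<in> V - J" using Suc.prems by blast
  have fin: "finite J" using Suc.prems finV finite_subset by blast
  have c: "card (insert v J) = Suc (card J)" using v fin by simp
  have "expect V X = fact (card V - card (insert v J)) * expect (insert v J) X"
    using Suc.prems v Suc.hyps(2) c
    by (intro Suc.hyps) (auto intro: depends_on_mono)
  also have "\<dots> = fact m * (real (Suc m) * expect J X)"
  proof -
    have "real (card V) - real (card J) = real (Suc m)" "card V - card (insert v J) = m"
      using Suc.hyps(2) c by linarith+
    then show ?thesis
      using expect_insert_marginal[OF Suc.prems(1) v Suc.prems(2)] by simp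
  qed
  finally show ?case by (simp add: fact_Suc mult_ac flip: Suc.hyps(2))
qed

section \<open>Exact conditional expectations of sums over the remaining vertices\<close>

definition condexp :: "nat set \<Rightarrow> nat \<Rightarrow> ((nat \<Rightarrow> nat) \<Rightarrow> real) \<Rightarrow> (nat \<Rightarrow> nat) \<Rightarrow> real" where
  "condexp J v F c = (\<Sum>a\<in>V. trans_weight J c a * F (c(v := a)))"

text \<open>Compare the coefficients of \<open>F (c(v := a))\<close>. Their difference
  \<open>q a\<close> vanishes on the colours of \<open>J\<close>, because each vertex of
  \<open>M - J\<close> with colour \<open>a\<close> lowers \<open>s - occ\<close> by one, and it
  sums to 0 over all colours. Off the colours of \<open>J\<close> the value of \<open>F\<close> does
  not depend on \<open>a\<close>. The identity is pointwise, hence it also covers colourings of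
  weight 0.\<close>

lemma condexp_extend:
  assumes J: "J \<subseteq> V" "v \<notin> J" and F: "pattern_local (insert v J) F"
    and M: "J \<subseteq> M" "M \<subseteq> V" "card M < card V" and c: "c ` M \<subseteq> V"
  shows "(\<Sum>u\<in>M - J. F (c(v := c u))) + (\<Sum>a\<in>V. trans_weight M c a * F (c(v := a)))
      = condexp J v F c"
proof -
  have fin: "finite M" "finite J" using J(1) M(2) finV finite_subset by blast+
  have cJ: "c ` J \<subseteq> V" using c M(1) by auto
  have cardJ: "card J \<le> card M" using M fin by (intro card_mono) auto
  define q where "q a = real (occ (M - J) c a) + trans_weight M c a - trans_weight J c a" for a
  have "occ M c a = occ J c a + occ (M - J) c a" for a
  proof -
    have "{v\<in>M. c v = a} = {v\<in>J. c v = a} \<union> {v\<in>M-J. c v = a}" using M(1) by auto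
    then show ?thesis unfolding occ_def using fin
      by (simp add: card_Un_disjoint[symmetric] disjoint_iff)
  qed
  then have q0: "q a = 0" if "a \<in> c ` J" for a
    using that M(1) by (auto simp: q_def trans_weight_def)
  have "(\<Sum>a\<in>V. real (occ (M - J) c a)) = real (card (M - J))"
    using sum_by_colour[of "M - J" V c "\<lambda>_. 1"] finV fin c by (auto simp: image_subset_iff)
  then have sq: "(\<Sum>a\<in>V. q a) = 0"
    using sum_trans_weight[OF J(1) _ cJ] sum_trans_weight[OF M(2,3) c] M cardJ fin
    by (simp add: q_def sum.distrib sum_subtractf card_Diff_subset of_nat_diff)
  have const: "F (c(v := a)) = F (c(v := b))" if "a \<notin> c ` J" "b \<notin> c ` J" for a b
    using that J(2) by (intro pattern_localD[OF F]) auto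
  have "(\<Sum>a\<in>V. q a * F (c(v := a))) = 0"
  proof (cases "V \<subseteq> c ` J")
    case True
    then show ?thesis using q0 by (intro sum.neutral) auto
  next
    case False
    then obtain b where b: "b \<notin> c ` J" by auto
    have "(\<Sum>a\<in>V. q a * F (c(v := a))) = (\<Sum>a\<in>V. q a * F (c(v := b)))"
      using q0 const[OF _ b] by (intro sum.cong) (auto, metis)
    also have "\<dots> = 0" using sq by (simp flip: sum_distrib_right)
    finally show ?thesis .
  qed
  moreover have "(\<Sum>u\<in>M - J. F (c(v := c u))) = (\<Sum>a\<in>V. real (occ (M - J) c a) * F (c(v := a)))"
    using finV fin c by (intro sum_by_colour[of "M - J" V c "\<lambda>a. F (c(v := a))"]) auto
  ultimately show ?thesis
    by (simp add: q_def condexp_def algebra_simps sum.distrib sum_subtractf)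
qed

lemma trans_weight_cong: "(\<And>i. i \<in> J \<Longrightarrow> c i = c' i) \<Longrightarrow> trans_weight J c a = trans_weight J c' a"
proof -
  assume *: "\<And>i. i \<in> J \<Longrightarrow> c i = c' i"
  have "c ` J = c' ` J" "{v\<in>J. c v = a} = {v\<in>J. c' v = a}" using * by force+
  then show ?thesis by (simp only: trans_weight_def occ_def)
qed

lemma depends_on_condexp:
  assumes "pattern_local (insert v J) F"
  shows "depends_on J (condexp J v F)"
proof -
  have "condexp J v F c = condexp J v F c'" if *: "\<And>i. i \<in> J \<Longrightarrow> c i = c' i" for c c'
    unfolding condexp_def
  proof (intro sum.cong refl)
    fix a
    have "F (c(v := a)) = F (c'(v := a))"
      using * by (intro pattern_localD[OF assms]) auto
    then show "trans_weight J c a * F (c(v := a)) = trans_weight J c' a * F (c'(v := a))"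
      using trans_weight_cong[OF *] by simp
  qed
  then show ?thesis unfolding depends_on_def by blast
qed

lemma expect_sum: "expect J (\<lambda>c. \<Sum>i\<in>A. X i c) = (\<Sum>i\<in>A. expect J (X i))"
  unfolding expect_def by (simp add: sum_distrib_left sum.swap[of _ A])

lemma expect_add: "expect J (\<lambda>c. X c + Y c) = expect J X + expect J Y"
  unfolding expect_def by (simp add: algebra_simps sum.distrib)

lemma expect_diff: "expect J (\<lambda>c. X c - Y c) = expect J X - expect J Y"
  unfolding expect_def by (simp add: algebra_simps sum_subtractf)

lemma expect_scale: "expect J (\<lambda>c. r * X c) = r * expect J X"
  unfolding expect_def by (simp add: sum_distrib_left mult_ac)

lemma expect_cong: "(\<And>c. c \<in> PiE J (\<lambda>_. V) \<Longrightarrow> X c = Y c) \<Longrightarrow> expect J X = expect J Y"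
  unfolding expect_def by (simp cong: sum.cong)

text \<open>Here \<open>v\<close> is a mere slot of \<open>F\<close>, filled with the colour of
  \<open>u\<close>. On \<open>M = J \<union> K\<close> the terms with \<open>u \<in> M - J\<close>
  are already determined, while every other \<open>u\<close> is marginalised to
  \<open>insert u M\<close> and yields the same value; \<open>condexp_extend\<close> combines the
  two kinds.\<close>

lemma expect_condexp:
  assumes J: "J \<subseteq> V" "v \<notin> J" and F: "pattern_local (insert v J) F"
    and X: "depends_on K X" "K \<subseteq> V" and small: "card (J \<union> K) < card V"
  shows "expect V (\<lambda>c. X c * (\<Sum>u\<in>V - J. F (c(v := c u))))
       = expect V (\<lambda>c. X c * condexp J v F c)"
proof -
  define M where "M = J \<union> K"
  have M: "J \<subseteq> M" "K \<subseteq> M" "M \<subseteq> V" "card M < card V" using J X small by (auto simp: M_def)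
  have fin: "finite M" using M(3) finV finite_subset by blast
  have XM: "depends_on M X" using X(1) M(2) by (rule depends_on_mono)
  let ?G = "\<lambda>c. \<Sum>a\<in>V. trans_weight M c a * F (c(v := a))"
  have new: "expect V (\<lambda>c. X c * F (c(v := c u)))
      = fact (card V - card M - 1) * expect M (\<lambda>c. X c * ?G c)" if u: "u \<in> V - M" for u
  proof -
    have dep: "depends_on (insert u M) (\<lambda>c. X c * F (c(v := c u)))"
      unfolding depends_on_def
    proof (intro allI impI)
      fix c c' :: "nat \<Rightarrow> nat" assume *: "\<forall>i\<in>insert u M. c i = c' i"
      have "X c = X c'" using * by (intro depends_onD[OF XM]) auto
      moreover have "F (c(v := c u)) = F (c'(v := c' u))"
          using * M(1) by (intro pattern_localD[OF F]) (auto simp: subset_eq)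
      ultimately show "X c * F (c(v := c u)) = X c' * F (c'(v := c' u))" by simp
    qed
    have cu: "card V - card (insert u M) = card V - card M - 1" using u fin by simp
    have "expect V (\<lambda>c. X c * F (c(v := c u)))
        = fact (card V - card M - 1) * expect (insert u M) (\<lambda>c. X c * F (c(v := c u)))"
      unfolding cu[symmetric] using u M by (intro expect_marginal[OF _ dep]) auto
    also have "expect (insert u M) (\<lambda>c. X c * F (c(v := c u)))
        = (\<Sum>c\<in>PiE M (\<lambda>_. V). weight M c * (\<Sum>a\<in>V. trans_weight M c a * (X c * F (c(v := a)))))"
    proof (subst expect_insert)
      have *: "X (c(u := a)) * F ((c(u := a))(v := (c(u := a)) u)) = X c * F (c(v := a))" for c a
      proof -
        have "X (c(u := a)) = X c" using u by (intro depends_onD[OF XM]) auto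
        moreover have "F ((c(u := a))(v := a)) = F (c(v := a))"
          using u M(1) by (intro pattern_localD[OF F]) auto
        ultimately show ?thesis by simp
      qed
      show "(\<Sum>c\<in>PiE M (\<lambda>_. V). weight M c * (\<Sum>a\<in>V. trans_weight M c a *
          (X (c(u := a)) * F ((c(u := a))(v := (c(u := a)) u)))))
        = (\<Sum>c\<in>PiE M (\<lambda>_. V). weight M c * (\<Sum>a\<in>V. trans_weight M c a * (X c * F (c(v := a)))))"
        unfolding * ..
    qed (use u M in auto)
    also have "\<dots> = expect M (\<lambda>c. X c * ?G c)"
      unfolding expect_def by (intro sum.cong refl) (simp add: sum_distrib_left mult_ac)
    finally show ?thesis .
  qed
  have old: "expect V (\<lambda>c. X c * (\<Sum>u\<in>M - J. F (c(v := c u))))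
      = fact (card V - card M) * expect M (\<lambda>c. X c * (\<Sum>u\<in>M - J. F (c(v := c u))))"
  proof (rule expect_marginal[OF M(3)], unfold depends_on_def, intro allI impI)
    fix c c' :: "nat \<Rightarrow> nat" assume *: "\<forall>i\<in>M. c i = c' i"
    have "X c = X c'" using * by (intro depends_onD[OF XM]) auto
    moreover have "F (c(v := c u)) = F (c'(v := c' u))" if "u \<in> M" for u
      using * M(1) that by (intro pattern_localD[OF F]) (auto simp: subset_eq)
    ultimately show "X c * (\<Sum>u\<in>M - J. F (c(v := c u))) = X c' * (\<Sum>u\<in>M - J. F (c'(v := c' u)))"
      by simp
  qed
  have "expect V (\<lambda>c. X c * (\<Sum>u\<in>V - J. F (c(v := c u))))
      = expect V (\<lambda>c. X c * (\<Sum>u\<in>M - J. F (c(v := c u))) + (\<Sum>u\<in>V - M. X c * F (c(v := c u))))"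
  proof -
    have "V - J = (V - M) \<union> (M - J)" using M by auto
    then have "(\<Sum>u\<in>V - J. F (c(v := c u)))
      = (\<Sum>u\<in>V - M. F (c(v := c u))) + (\<Sum>u\<in>M - J. F (c(v := c u)))" for c
      using finV fin by (simp add: sum.union_disjoint disjoint_iff)
    then show ?thesis by (simp add: algebra_simps sum_distrib_left)
  qed
  also have "\<dots> = fact (card V - card M) * expect M (\<lambda>c. X c * (\<Sum>u\<in>M - J. F (c(v := c u))))
      + real (card V - card M) * (fact (card V - card M - 1) * expect M (\<lambda>c. X c * ?G c))"
    using M fin by (simp only: expect_add expect_sum old) (simp add: new card_Diff_subset)
  \<comment> \<open>There are \<open>card V - card M > 0\<close> new vertices, and this number times
    the factorial of its predecessor is the factor of the old terms.\<close>
  also have "\<dots> = fact (card V - card M) * expect M (\<lambda>c. X c * ((\<Sum>u\<in>M - J. F (c(v := c u))) + ?G c))"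
    using M(4) by (simp add: fact_reduce[of "card V - card M"] expect_add algebra_simps)
  also have "expect M (\<lambda>c. X c * ((\<Sum>u\<in>M - J. F (c(v := c u))) + ?G c))
      = expect M (\<lambda>c. X c * condexp J v F c)"
    by (intro expect_cong) (subst condexp_extend[OF J F M(1,3,4)], auto simp: PiE_iff image_subset_iff)
  also have "fact (card V - card M) * \<dots> = expect V (\<lambda>c. X c * condexp J v F c)"
  proof (rule expect_marginal[OF M(3), symmetric])
    have "depends_on M (condexp J v F)"
      using depends_on_condexp[OF F] M(1) by (rule depends_on_mono)
    then show "depends_on M (\<lambda>c. X c * condexp J v F c)"
      using XM unfolding depends_on_def by metis
  qed
  finally show ?thesis .
qed

end

section \<open>Symmetrisation over the vertices outside a set\<close>

context fractional_partition
begin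

lemma expect_permute:
  assumes "\<sigma> permutes V"
  shows "expect V (\<lambda>c. X (c \<circ> \<sigma>)) = expect V X"
proof -
  have inv: "inv \<sigma> permutes V" using assms by (rule permutes_inv)
  have w: "weight V (c \<circ> \<sigma>) = weight V c" for c
  proof -
    have "bij_betw \<sigma> {v\<in>V. c (\<sigma> v) = a} {v\<in>V. c v = a}" for a
      unfolding bij_betw_def
    proof
      show "inj_on \<sigma> {v\<in>V. c (\<sigma> v) = a}" using assms by (rule permutes_inj_on)
      show "\<sigma> ` {v\<in>V. c (\<sigma> v) = a} = {v\<in>V. c v = a}"
      proof (intro equalityI subsetI)
        fix v assume "v \<in> {v\<in>V. c v = a}"
        then show "v \<in> \<sigma> ` {v\<in>V. c (\<sigma> v) = a}"
          using permutes_inverses(1)[OF assms] permutes_in_image[OF inv]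
          by (intro image_eqI[of _ _ "inv \<sigma> v"]) auto
      qed (use permutes_in_image[OF assms] in auto)
    qed
    then have "occ V (c \<circ> \<sigma>) a = occ V c a" for a
      using bij_betw_same_card unfolding occ_def comp_apply by blast
    moreover have "(c \<circ> \<sigma>) ` V = c ` V"
      using permutes_image[OF assms] by (metis image_comp)
    ultimately show ?thesis by (simp add: weight_def)
  qed
  have ext: "c \<circ> \<tau> \<in> PiE V (\<lambda>_. V)" if "\<tau> permutes V" "c \<in> PiE V (\<lambda>_. V)" for c \<tau>
    using that by (auto simp: PiE_iff extensional_def permutes_in_image permutes_not_in)
  show ?thesis
    unfolding expect_def
    by (rule sum.reindex_bij_witness[where i = "\<lambda>c. c \<circ> inv \<sigma>" and j = "\<lambda>c. c \<circ> \<sigma>"])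
       (use ext assms inv w in \<open>auto simp: comp_assoc permutes_inv_o[OF assms]\<close>)
qed

text \<open>
  \<open>condexp\<close> rewritten without reference to the names of the colours, hence local in the partition.
\<close>

definition condexp_pat :: "nat set \<Rightarrow> nat \<Rightarrow> ((nat \<Rightarrow> nat) \<Rightarrow> real) \<Rightarrow> (nat \<Rightarrow> nat) \<Rightarrow> real" where
  "condexp_pat J v F c = (\<Sum>j\<in>J. (s / real (occ J c (c j)) - 1) * F (c(v := c j)))
     + s * (k - real (card (c ` J))) * F (c(v := (SOME a. a \<notin> c ` J)))"

lemma new_colour: "finite J \<Longrightarrow> (SOME a. a \<notin> c ` J) \<notin> c ` (J :: nat set)" for c :: "nat \<Rightarrow> nat"
  by (rule someI_ex) (rule ex_new_if_finite, auto)

lemma occ_pos: "finite J \<Longrightarrow> a \<in> c ` J \<Longrightarrow> occ J c a > 0"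
  by (auto simp: occ_def card_gt_0_iff)

text \<open>Each vertex of a class of size \<open>b\<close> carries \<open>s / b - 1\<close>, so the
  class carries \<open>s - b\<close>. All colours not in use give one value of \<open>F\<close>, and
  their number cancels the denominator in \<open>trans_weight\<close>.\<close>

lemma condexp_eq_pat:
  assumes J: "J \<subseteq> V" "card J < card V" "v \<notin> J" and F: "pattern_local (insert v J) F"
    and c: "c ` J \<subseteq> V"
  shows "condexp J v F c = condexp_pat J v F c"
proof -
  have fin: "finite J" using J(1) finV finite_subset by blast
  have less: "card (c ` J) < card V" using J by (intro card_image_less)
  define b where "b = (SOME a. a \<notin> c ` J)"
  have b: "b \<notin> c ` J" unfolding b_def using fin by (rule new_colour)
  have "(\<Sum>a\<in>V - c ` J. F (c(v := a))) = (\<Sum>a\<in>V - c ` J. F (c(v := b)))"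
    using b J(3) by (intro sum.cong refl pattern_localD[OF F]) auto
  then have 1: "(\<Sum>a\<in>V - c ` J. F (c(v := a))) = (real (card V) - real (card (c ` J))) * F (c(v := b))"
    using c fin less by (simp add: card_Diff_subset of_nat_diff)
  have "(\<Sum>j\<in>J. (s / real (occ J c (c j)) - 1) * F (c(v := c j)))
      = (\<Sum>a\<in>c ` J. real (occ J c a) * ((s / real (occ J c a) - 1) * F (c(v := a))))"
    using fin by (intro sum_by_colour[of J "c ` J" c "\<lambda>a. (s / real (occ J c a) - 1) * F (c(v := a))"]) auto
  also have "\<dots> = (\<Sum>a\<in>c ` J. (s - real (occ J c a)) * F (c(v := a)))"
  proof (intro sum.cong refl)
    fix a assume "a \<in> c ` J"
    then have "occ J c a > 0" by (rule occ_pos[OF fin])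
    then show "real (occ J c a) * ((s / real (occ J c a) - 1) * F (c(v := a)))
        = (s - real (occ J c a)) * F (c(v := a))" by (simp add: field_simps)
  qed
  finally show ?thesis
    unfolding condexp_def condexp_pat_def sum_trans_weight_split[OF J(1) c] 1 b_def[symmetric]
    using less by simp
qed

text \<open>This lets \<open>condexp_pat\<close> take the place of \<open>F\<close> in the induction
  of \<open>symmetrize_reduce\<close>. The number of colours is a function of the pattern because it
  is the sum over the vertices of the reciprocal class sizes.\<close>

lemma pattern_local_condexp_pat:
  assumes "finite J" "v \<notin> J" and F: "pattern_local (insert v J) F"
  shows "pattern_local J (condexp_pat J v F)"
  unfolding pattern_local_def
proof (intro allI impI)
  fix c c' :: "nat \<Rightarrow> nat"
  assume *: "\<forall>i\<in>J. \<forall>j\<in>J. c i = c j \<longleftrightarrow> c' i = c' j"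
  have o: "occ J c (c j) = occ J c' (c' j)" if "j \<in> J" for j
  proof -
    have "{v\<in>J. c v = c j} = {v\<in>J. c' v = c' j}" using * that by blast
    then show ?thesis by (simp add: occ_def)
  qed
  have colours: "real (card (d ` J)) = (\<Sum>j\<in>J. 1 / real (occ J d (d j)))" for d :: "nat \<Rightarrow> nat"
  proof -
    have "(\<Sum>j\<in>J. 1 / real (occ J d (d j))) = (\<Sum>a\<in>d ` J. real (occ J d a) * (1 / real (occ J d a)))"
      using assms(1) by (intro sum_by_colour[of J "d ` J" d "\<lambda>a. 1 / real (occ J d a)"]) auto
    also have "\<dots> = (\<Sum>a\<in>d ` J. 1)"
      using occ_pos[OF assms(1)] by (intro sum.cong) auto
    finally show ?thesis by simp
  qed
  have card: "card (c ` J) = card (c' ` J)"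
    using colours[of c] colours[of c'] o by simp
  have "F (c(v := c j)) = F (c'(v := c' j))" if "j \<in> J" for j
    using * that assms(2) by (intro pattern_localD[OF F]) auto
  moreover have "F (c(v := (SOME a. a \<notin> c ` J))) = F (c'(v := (SOME a. a \<notin> c' ` J)))"
    using * new_colour[OF assms(1), of c] new_colour[OF assms(1), of c'] assms(2)
    by (intro pattern_localD[OF F]) (auto simp: image_iff)
  ultimately show "condexp_pat J v F c = condexp_pat J v F c'"
    unfolding condexp_pat_def card using o by simp
qed

definition symmetrize :: "nat set \<Rightarrow> ((nat \<Rightarrow> nat) \<Rightarrow> real) \<Rightarrow> (nat \<Rightarrow> nat) \<Rightarrow> real" where
  "symmetrize I F c = (\<Sum>\<sigma>\<in>{\<sigma>. \<sigma> permutes (V - I)}. F (c \<circ> \<sigma>))"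

text \<open>For \<open>u\<close> other than \<open>v\<close>, the function \<open>F\<close> does not
  read the colour of \<open>u\<close>; giving \<open>v\<close> that colour is then the same as
  exchanging \<open>u\<close> and \<open>v\<close>, and the sum over permutations absorbs the
  transposition.\<close>

lemma symmetrize_replace:
  assumes F: "pattern_local (insert v J) F" and "v \<in> V - I" "u \<in> V - I" "v \<notin> J" "u \<notin> J"
  shows "symmetrize I (\<lambda>c. F (c(v := c u))) = symmetrize I F"
proof
  fix c :: "nat \<Rightarrow> nat"
  have t: "transpose v u permutes (V - I)" using assms by (intro permutes_swap_id)
  have "F ((c \<circ> \<sigma>)(v := (c \<circ> \<sigma>) u)) = F (c \<circ> (\<sigma> \<circ> transpose v u))" for \<sigma>
    using assms(4,5) by (intro pattern_localD[OF F]) (auto simp: transpose_def)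
  then show "symmetrize I (\<lambda>c. F (c(v := c u))) c = symmetrize I F c"
    unfolding symmetrize_def sum_permutations_compose_right[OF t, of "\<lambda>\<sigma>. F (c \<circ> \<sigma>)"]
    by simp
qed

lemma depends_on_permute:
  assumes "depends_on K X"
  shows "depends_on (\<sigma> ` K) (\<lambda>c. X (c \<circ> \<sigma>))"
  unfolding depends_on_def by (auto intro!: depends_onD[OF assms])

lemma pattern_local_replace:
  assumes F: "pattern_local (insert v J) F" and "v \<notin> J"
  shows "pattern_local (insert u J) (\<lambda>c. F (c(v := c u)))"
  unfolding pattern_local_def using assms(2) by (auto intro!: pattern_localD[OF F])

lemma permutes_outside: "\<sigma> permutes (V - I) \<Longrightarrow> \<sigma> permutes V"
  by (rule permutes_subset) auto

text \<open>Invariance of the expectation moves each permutation from \<open>F\<close> to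
  \<open>X\<close>, which then depends on an image of \<open>K\<close>. As the image varies, the
  bound is on \<open>card J + card K\<close> and not on the union.\<close>

lemma expect_symmetrize_condexp:
  assumes J: "J \<subseteq> V" "v \<notin> J" and F: "pattern_local (insert v J) F"
    and X: "depends_on K X" "K \<subseteq> V" and small: "card J + card K < card V"
  shows "expect V (\<lambda>c. X c * symmetrize I (\<lambda>c. \<Sum>u\<in>V - J. F (c(v := c u))) c)
       = expect V (\<lambda>c. X c * symmetrize I (condexp_pat J v F) c)"
proof -
  have eq: "expect V (\<lambda>c. X c * (\<Sum>u\<in>V - J. F ((c \<circ> \<sigma>)(v := (c \<circ> \<sigma>) u))))
      = expect V (\<lambda>c. X c * condexp_pat J v F (c \<circ> \<sigma>))" if "\<sigma> permutes (V - I)" for \<sigma>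
  proof -
    have \<sigma>: "\<sigma> permutes V" using that by (rule permutes_outside)
    note i = permutes_inv[OF \<sigma>]
    define Y where "Y c = X (c \<circ> inv \<sigma>)" for c
    have Y: "X c = Y (c \<circ> \<sigma>)" for c
      by (simp add: Y_def comp_assoc permutes_inv_o[OF \<sigma>])
    have dY: "depends_on (inv \<sigma> ` K) Y"
      unfolding Y_def using X(1) by (rule depends_on_permute)
    have KY: "inv \<sigma> ` K \<subseteq> V" using X(2) permutes_in_image[OF i] by auto
    have "card (inv \<sigma> ` K) = card K"
      by (intro card_image permutes_inj_on[OF i])
    then have small': "card (J \<union> inv \<sigma> ` K) < card V"
      using small card_Un_le[of J "inv \<sigma> ` K"] by simp
    have "expect V (\<lambda>c. X c * (\<Sum>u\<in>V - J. F ((c \<circ> \<sigma>)(v := (c \<circ> \<sigma>) u))))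
        = expect V (\<lambda>c. Y c * (\<Sum>u\<in>V - J. F (c(v := c u))))"
      unfolding Y by (rule expect_permute[OF \<sigma>])
    also have "\<dots> = expect V (\<lambda>c. Y c * condexp J v F c)"
      by (rule expect_condexp[OF J F dY KY small'])
    also have "\<dots> = expect V (\<lambda>c. Y c * condexp_pat J v F c)"
      using small J F by (intro expect_cong) (subst condexp_eq_pat, auto simp: PiE_iff)
    also have "\<dots> = expect V (\<lambda>c. X c * condexp_pat J v F (c \<circ> \<sigma>))"
      unfolding Y by (rule expect_permute[OF \<sigma>, symmetric])
    finally show ?thesis .
  qed
  show ?thesis
    unfolding symmetrize_def sum_distrib_left[of _ _ "{\<sigma>. \<sigma> permutes (V - I)}"] expect_sum
    by (intro sum.cong refl eq) simp
qed

lemma symmetrize_sum: "symmetrize I (\<lambda>c. \<Sum>u\<in>A. F u c) c = (\<Sum>u\<in>A. symmetrize I (F u) c)"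
  unfolding symmetrize_def by (rule sum.swap)

text \<open>
  The vertex \<open>v\<close> of \<open>F\<close> is averaged over all vertices outside \<open>I\<close> and \<open>J\<close>; the sum over all vertices outside
  \<open>J\<close> is a conditional expectation, and the terms in \<open>I\<close> involve fewer vertices outside \<open>I\<close>.
\<close>

lemma symmetrize_reduce:
  assumes I: "I \<subseteq> V" and D: "2 * D \<le> card V"
    and "J \<subseteq> V" "card J \<le> D" "pattern_local J F"
  shows "\<exists>h. depends_on I h \<and> (\<forall>K X. K \<subseteq> V \<longrightarrow> card K \<le> D \<longrightarrow> depends_on K X \<longrightarrow>
    expect V (\<lambda>c. X c * symmetrize I F c) = expect V (\<lambda>c. X c * h c))"
  using assms(3-5)
proof (induction "card (J - I)" arbitrary: J F rule: less_induct)
  case less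
  have fin: "finite J" using less.prems finV finite_subset by blast
  show ?case
  proof (cases "J \<subseteq> I")
    case True
    have "symmetrize I F c = real (card {\<sigma>. \<sigma> permutes (V - I)}) * F c" for c
    proof -
      have "F (c \<circ> \<sigma>) = F c" if "\<sigma> permutes (V - I)" for \<sigma>
        using True permutes_not_in[OF that] by (intro pattern_localD[OF less.prems(3)]) (metis DiffD2 comp_apply subsetD)
      then show ?thesis by (simp add: symmetrize_def)
    qed
    moreover have "depends_on I (\<lambda>c. real (card {\<sigma>. \<sigma> permutes (V - I)}) * F c)"
      using depends_on_mono[OF pattern_local_imp_depends_on[OF less.prems(3)] True]
      unfolding depends_on_def by metis
    ultimately show ?thesis by (intro exI[of _ "\<lambda>c. real (card {\<sigma>. \<sigma> permutes (V - I)}) * F c"]) simp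
  next
    case False
    then obtain v where v: "v \<in> J" "v \<notin> I" by blast
    define J' where "J' = J - {v}"
    have J: "J = insert v J'" "v \<notin> J'" "finite J'" using v fin by (auto simp: J'_def)
    have J': "J' \<subseteq> V" "card J' < D" "v \<in> V" using less.prems J by auto
    have F: "pattern_local (insert v J') F" using less.prems J by simp
    have smaller: "card (J' - I) < card (J - I)"
      using v fin by (intro psubset_card_mono) (auto simp: J'_def)
    have pat: "pattern_local J' (condexp_pat J' v F)"
      using J F by (intro pattern_local_condexp_pat)
    obtain h0 where h0: "depends_on I h0" "\<And>K X. K \<subseteq> V \<Longrightarrow> card K \<le> D \<Longrightarrow> depends_on K X \<Longrightarrow>
        expect V (\<lambda>c. X c * symmetrize I (condexp_pat J' v F) c) = expect V (\<lambda>c. X c * h0 c)"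
      using less.hyps[OF smaller J'(1) _ pat] J'(2) by auto
    have "\<forall>u\<in>I - J'. \<exists>h. depends_on I h \<and> (\<forall>K X. K \<subseteq> V \<longrightarrow> card K \<le> D \<longrightarrow> depends_on K X \<longrightarrow>
        expect V (\<lambda>c. X c * symmetrize I (\<lambda>c. F (c(v := c u))) c) = expect V (\<lambda>c. X c * h c))"
    proof
      fix u assume u: "u \<in> I - J'"
      have "insert u J' - I = J' - I" using u by auto
      then have "card (insert u J' - I) < card (J - I)" using smaller by simp
      moreover have "insert u J' \<subseteq> V" using u I J' by auto
      moreover have "card (insert u J') \<le> D" using u J J' by simp
      ultimately
      show "\<exists>h. depends_on I h \<and> (\<forall>K X. K \<subseteq> V \<longrightarrow> card K \<le> D \<longrightarrow> depends_on K X \<longrightarrow>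
          expect V (\<lambda>c. X c * symmetrize I (\<lambda>c. F (c(v := c u))) c) = expect V (\<lambda>c. X c * h c))"
        by (rule less.hyps[OF _ _ _ pattern_local_replace[OF F J(2)]])
    qed
    from bchoice[OF this] obtain hu where hu: "\<forall>u\<in>I - J'. depends_on I (hu u) \<and>
      (\<forall>K X. K \<subseteq> V \<longrightarrow> card K \<le> D \<longrightarrow> depends_on K X \<longrightarrow>
        expect V (\<lambda>c. X c * symmetrize I (\<lambda>c. F (c(v := c u))) c) = expect V (\<lambda>c. X c * hu u c))" ..
    define W where "W = V - (I \<union> J')"
    have W: "finite W" "v \<in> W" using finV J v J' by (auto simp: W_def)
    then have W0: "real (card W) \<noteq> 0" by auto
    have split: "symmetrize I F c = (1 / real (card W)) *
        (symmetrize I (\<lambda>c. \<Sum>u\<in>V - J'. F (c(v := c u))) c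
          - (\<Sum>u\<in>I - J'. symmetrize I (\<lambda>c. F (c(v := c u))) c))" for c
    proof -
      have "V - J' = W \<union> (I - J')" "W \<inter> (I - J') = {}" using I by (auto simp: W_def)
      then have "symmetrize I (\<lambda>c. \<Sum>u\<in>V - J'. F (c(v := c u))) c
          = (\<Sum>u\<in>W. symmetrize I (\<lambda>c. F (c(v := c u))) c)
            + (\<Sum>u\<in>I - J'. symmetrize I (\<lambda>c. F (c(v := c u))) c)"
        unfolding symmetrize_sum using W(1) finite_subset[OF I finV] by (simp add: sum.union_disjoint)
      also have "(\<Sum>u\<in>W. symmetrize I (\<lambda>c. F (c(v := c u))) c) = (\<Sum>u\<in>W. symmetrize I F c)"
        using J(2) v(2) J' by (intro sum.cong refl fun_cong[OF symmetrize_replace[OF F]]) (auto simp: W_def)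
      also have "\<dots> = real (card W) * symmetrize I F c" by simp
      finally have diff: "symmetrize I (\<lambda>c. \<Sum>u\<in>V - J'. F (c(v := c u))) c
          - (\<Sum>u\<in>I - J'. symmetrize I (\<lambda>c. F (c(v := c u))) c) = real (card W) * symmetrize I F c"
        by linarith
      show ?thesis unfolding diff using W0 by simp
    qed
    define h where "h c = (1 / real (card W)) * (h0 c - (\<Sum>u\<in>I - J'. hu u c))" for c
    have "depends_on I h"
      unfolding depends_on_def
    proof (intro allI impI)
      fix c c' :: "nat \<Rightarrow> nat" assume "\<forall>i\<in>I. c i = c' i"
      then have "h0 c = h0 c'" "\<And>u. u \<in> I - J' \<Longrightarrow> hu u c = hu u c'"
        using h0(1) hu unfolding depends_on_def by blast+
      then show "h c = h c'" by (simp add: h_def)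
    qed
    moreover have "expect V (\<lambda>c. X c * symmetrize I F c) = expect V (\<lambda>c. X c * h c)"
      if K: "K \<subseteq> V" "card K \<le> D" "depends_on K X" for K X
    proof -
      have expand: "expect V (\<lambda>c. X c * ((1 / r) * (A c - (\<Sum>u\<in>U. B u c))))
          = (1 / r) * (expect V (\<lambda>c. X c * A c) - (\<Sum>u\<in>U. expect V (\<lambda>c. X c * B u c)))" for r A B and U :: "nat set"
        unfolding expect_diff[symmetric] expect_sum[symmetric] expect_scale[symmetric]
        by (intro expect_cong) (simp add: sum_distrib_left right_diff_distrib mult_ac)
      \<comment> \<open>\<open>J'\<close> has fewer than \<open>D\<close> vertices and
        \<open>K\<close> at most \<open>D\<close>, so \<open>2 * D \<le> card V\<close> gives the
        strict inequality.\<close>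
      have "card J' + card K < card V" using K(2) J'(2) D by linarith
      then have "expect V (\<lambda>c. X c * symmetrize I (\<lambda>c. \<Sum>u\<in>V - J'. F (c(v := c u))) c)
          = expect V (\<lambda>c. X c * h0 c)"
        unfolding h0(2)[OF K, symmetric] using J J' K by (intro expect_symmetrize_condexp[OF _ _ F]) auto
      then show ?thesis
        unfolding split h_def expand using hu K by simp
    qed
    ultimately show ?thesis by blast
  qed
qed

lemma expect_square_nonneg:
  assumes I: "I \<subseteq> V" "real (card I) \<le> s + 1" "real (card I) \<le> k + 1" and h: "depends_on I h"
  shows "0 \<le> expect V (\<lambda>c. (h c)\<^sup>2)"
proof -
  have fin: "finite I" using I finV finite_subset by blast
  have "0 \<le> weight I c" for c
  proof -
    have *: "card (c ` I) \<le> card I" using fin by (rule card_image_le)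
    have "occ I c a \<le> card I" for a unfolding occ_def using fin by (intro card_mono) auto
    then have "0 \<le> falling s (occ I c a)" for a
      using I(2) by (intro falling_nonneg) (meson of_nat_le_iff order_trans)
    moreover have "0 \<le> falling k (card (c ` I))"
      using * I(3) by (intro falling_nonneg) (meson of_nat_le_iff order_trans)
    moreover have "0 \<le> falling (real (card V)) (card (c ` I))"
      using falling_pos[OF order_trans[OF * card_mono[OF finV I(1)]]] by simp
    ultimately show ?thesis unfolding weight_def by (intro mult_nonneg_nonneg divide_nonneg_nonneg prod_nonneg) auto
  qed
  then have "0 \<le> expect I (\<lambda>c. (h c)\<^sup>2)"
    unfolding expect_def by (intro sum_nonneg mult_nonneg_nonneg) auto
  moreover have "depends_on I (\<lambda>c. (h c)\<^sup>2)"
    using h unfolding depends_on_def by metis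
  ultimately show ?thesis by (subst expect_marginal[OF I(1)]) auto
qed

text \<open>Let \<open>g\<close> be the symmetrised function and \<open>h\<close> its substitute on
  \<open>I\<close>. The substitution is valid only against functions of at most \<open>D\<close>
  vertices, whereas \<open>g\<close> may involve all of them. So \<open>g * g\<close> is turned into
  \<open>g * h\<close> by splitting the other factor \<open>g\<close> into its summands
  \<open>F t (c \<circ> \<sigma>)\<close>, and \<open>h * g\<close> into \<open>h * h\<close>
  directly.\<close>

lemma expect_symmetrize_square_nonneg:
  assumes I: "I \<subseteq> V" "card I \<le> D" and D: "2 * D \<le> card V" "real D \<le> s + 1" "real D \<le> k + 1"
    and T: "\<And>t. t \<in> T \<Longrightarrow> J t \<subseteq> V" "\<And>t. t \<in> T \<Longrightarrow> card (J t) \<le> D"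
      "\<And>t. t \<in> T \<Longrightarrow> pattern_local (J t) (F t)"
  shows "0 \<le> expect V (\<lambda>c. (symmetrize I (\<lambda>c. \<Sum>t\<in>T. x t * F t c) c)\<^sup>2)"
proof -
  have "\<forall>t\<in>T. \<exists>h. depends_on I h \<and> (\<forall>K X. K \<subseteq> V \<longrightarrow> card K \<le> D \<longrightarrow> depends_on K X \<longrightarrow>
      expect V (\<lambda>c. X c * symmetrize I (F t) c) = expect V (\<lambda>c. X c * h c))"
    using symmetrize_reduce[OF I(1) D(1)] T by blast
  then obtain H where H: "\<And>t. t \<in> T \<Longrightarrow> depends_on I (H t)"
    "\<And>t K X. t \<in> T \<Longrightarrow> K \<subseteq> V \<Longrightarrow> card K \<le> D \<Longrightarrow> depends_on K X \<Longrightarrow>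
      expect V (\<lambda>c. X c * symmetrize I (F t) c) = expect V (\<lambda>c. X c * H t c)"
    by metis
  define g where "g c = symmetrize I (\<lambda>c. \<Sum>t\<in>T. x t * F t c) c" for c
  define h where "h c = (\<Sum>t\<in>T. x t * H t c)" for c
  have g: "g c = (\<Sum>t\<in>T. x t * symmetrize I (F t) c)" for c
    unfolding g_def symmetrize_sum by (simp add: symmetrize_def sum_distrib_left)
  have h: "depends_on I h"
    using H(1) unfolding depends_on_def h_def by (metis (no_types, lifting) sum.cong)
  have gh: "expect V (\<lambda>c. X c * g c) = expect V (\<lambda>c. X c * h c)"
    if "K \<subseteq> V" "card K \<le> D" "depends_on K X" for K X
  proof -
    have "expect V (\<lambda>c. X c * (\<Sum>t\<in>T. x t * A t c)) = (\<Sum>t\<in>T. x t * expect V (\<lambda>c. X c * A t c))" for A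
      unfolding expect_scale[symmetric] expect_sum[symmetric] by (simp add: sum_distrib_left mult_ac)
    then show ?thesis unfolding g h_def using H(2)[OF _ that] by simp
  qed
  have gX: "expect V (\<lambda>c. g c * Y c)
      = (\<Sum>t\<in>T. \<Sum>\<sigma>\<in>{\<sigma>. \<sigma> permutes (V - I)}. x t * expect V (\<lambda>c. F t (c \<circ> \<sigma>) * Y c))" for Y
    unfolding expect_scale[symmetric] expect_sum[symmetric]
    unfolding g symmetrize_def by (simp add: sum_distrib_left sum_distrib_right mult_ac)
  have "expect V (\<lambda>c. g c * g c) = expect V (\<lambda>c. g c * h c)"
    unfolding gX
  proof (intro sum.cong refl arg_cong2[of _ _ _ _ "(*)"])
    fix t \<sigma> assume t: "t \<in> T" and "\<sigma> \<in> {\<sigma>. \<sigma> permutes (V - I)}"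
    then have \<sigma>: "\<sigma> permutes V" using permutes_outside by blast
    have "card (\<sigma> ` J t) \<le> D"
      using T(2)[OF t] by (simp add: card_image permutes_inj_on[OF \<sigma>])
    moreover have "\<sigma> ` J t \<subseteq> V"
      using T(1)[OF t] permutes_in_image[OF \<sigma>] by auto
    ultimately show "expect V (\<lambda>c. F t (c \<circ> \<sigma>) * g c) = expect V (\<lambda>c. F t (c \<circ> \<sigma>) * h c)"
      by (intro gh[OF _ _ depends_on_permute[OF pattern_local_imp_depends_on[OF T(3)[OF t]]]])
  qed
  also have "\<dots> = expect V (\<lambda>c. h c * g c)" by (simp add: mult.commute)
  also have "\<dots> = expect V (\<lambda>c. h c * h c)" by (rule gh[OF I h])
  also have "\<dots> \<ge> 0"
    using expect_square_nonneg[OF I(1) _ _ h] I(2) D(2,3) by (simp add: power2_eq_square)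
  finally show ?thesis unfolding g_def by (simp add: power2_eq_square)
qed

end

section \<open>Positivity of invariant quadratic forms\<close>

text \<open>Cauchy-Schwarz for \<open>R\<close>, from the nonnegative sum of
  \<open>R (f \<sigma> - f \<tau>)\<close> over all pairs. The two mixed terms agree after this
  summation even if \<open>C\<close> is not symmetric.\<close>

lemma sum_form_average_le:
  fixes R :: "('t \<Rightarrow> real) \<Rightarrow> real" and C :: "'t \<Rightarrow> 't \<Rightarrow> real"
  assumes R: "\<And>u. R u = (\<Sum>a\<in>T. \<Sum>b\<in>T. C a b * u a * u b)" and pos: "\<And>u. 0 \<le> R u"
  shows "R (\<lambda>a. \<Sum>\<sigma>\<in>G. f \<sigma> a) \<le> real (card G) * (\<Sum>\<sigma>\<in>G. R (f \<sigma>))"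
proof -
  define P where "P u w = (\<Sum>a\<in>T. \<Sum>b\<in>T. C a b * u a * w b)" for u w :: "'t \<Rightarrow> real"
  have diff: "R (\<lambda>a. u a - w a) = R u - P u w - P w u + R w" for u w
    unfolding R P_def by (simp add: algebra_simps sum.distrib sum_subtractf)
  have PG: "(\<Sum>\<sigma>\<in>G. \<Sum>\<tau>\<in>G. P (f \<sigma>) (f \<tau>)) = R (\<lambda>a. \<Sum>\<sigma>\<in>G. f \<sigma> a)"
  proof -
    have "(\<Sum>\<sigma>\<in>G. \<Sum>\<tau>\<in>G. P (f \<sigma>) (f \<tau>))
        = (\<Sum>\<sigma>\<in>G. \<Sum>a\<in>T. \<Sum>\<tau>\<in>G. \<Sum>b\<in>T. C a b * f \<sigma> a * f \<tau> b)"
      unfolding P_def by (intro sum.cong refl) (rule sum.swap)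
    also have "\<dots> = (\<Sum>a\<in>T. \<Sum>\<sigma>\<in>G. \<Sum>b\<in>T. \<Sum>\<tau>\<in>G. C a b * f \<sigma> a * f \<tau> b)"
      by (subst sum.swap) (intro sum.cong refl, rule sum.swap)
    also have "\<dots> = (\<Sum>a\<in>T. \<Sum>b\<in>T. \<Sum>\<sigma>\<in>G. \<Sum>\<tau>\<in>G. C a b * f \<sigma> a * f \<tau> b)"
      by (intro sum.cong refl) (rule sum.swap)
    also have "\<dots> = R (\<lambda>a. \<Sum>\<sigma>\<in>G. f \<sigma> a)"
      unfolding R by (intro sum.cong refl) (simp add: sum_distrib_left sum_distrib_right mult_ac)
    finally show ?thesis .
  qed
  have "0 \<le> (\<Sum>\<sigma>\<in>G. \<Sum>\<tau>\<in>G. R (\<lambda>a. f \<sigma> a - f \<tau> a))"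
    using pos by (intro sum_nonneg)
  also have "\<dots> = (\<Sum>\<sigma>\<in>G. \<Sum>\<tau>\<in>G. R (f \<sigma>)) - (\<Sum>\<sigma>\<in>G. \<Sum>\<tau>\<in>G. P (f \<sigma>) (f \<tau>))
      - (\<Sum>\<sigma>\<in>G. \<Sum>\<tau>\<in>G. P (f \<tau>) (f \<sigma>)) + (\<Sum>\<sigma>\<in>G. \<Sum>\<tau>\<in>G. R (f \<tau>))"
    unfolding diff by (simp add: sum.distrib sum_subtractf)
  also have "(\<Sum>\<sigma>\<in>G. \<Sum>\<tau>\<in>G. P (f \<tau>) (f \<sigma>)) = (\<Sum>\<sigma>\<in>G. \<Sum>\<tau>\<in>G. P (f \<sigma>) (f \<tau>))"
    by (rule sum.swap)
  finally show ?thesis unfolding PG by (simp flip: sum_distrib_left)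
qed

text \<open>
  No minimiser is needed: with \<open>- \<mu>\<close> the infimum of the Rayleigh quotient, the form shifted by \<open>\<mu>\<close> is
  nonnegative, so averaging does not increase it, while some coordinate of square at least
  \<open>1 / card T\<close> times the squared norm is preserved.
\<close>

lemma nonneg_form_by_averaging:
  fixes B :: "'t \<Rightarrow> 't \<Rightarrow> real" and act :: "'g \<Rightarrow> 't \<Rightarrow> 't"
  assumes T: "finite T"
    and G: "\<And>t. t \<in> T \<Longrightarrow> finite (G t)" "\<And>t. t \<in> T \<Longrightarrow> G t \<noteq> {}"
    and fixed: "\<And>t \<sigma>. t \<in> T \<Longrightarrow> \<sigma> \<in> G t \<Longrightarrow> act \<sigma> t = t"
    and bij: "\<And>t \<sigma>. t \<in> T \<Longrightarrow> \<sigma> \<in> G t \<Longrightarrow> bij_betw (act \<sigma>) T T"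
    and inv: "\<And>t \<sigma> a b. t \<in> T \<Longrightarrow> \<sigma> \<in> G t \<Longrightarrow> a \<in> T \<Longrightarrow> b \<in> T \<Longrightarrow> B (act \<sigma> a) (act \<sigma> b) = B a b"
    and avg: "\<And>t u. t \<in> T \<Longrightarrow> 0 \<le> (\<Sum>a\<in>T. \<Sum>b\<in>T. B a b * (\<Sum>\<sigma>\<in>G t. u (act \<sigma> a)) * (\<Sum>\<sigma>\<in>G t. u (act \<sigma> b)))"
  shows "0 \<le> (\<Sum>a\<in>T. \<Sum>b\<in>T. B a b * u a * u b)"
proof (rule ccontr)
  define Q where "Q u = (\<Sum>a\<in>T. \<Sum>b\<in>T. B a b * u a * u b)" for u :: "'t \<Rightarrow> real"
  define N where "N u = (\<Sum>a\<in>T. (u a)\<^sup>2)" for u :: "'t \<Rightarrow> real"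
  assume "\<not> ?thesis"
  then have neg: "Q u < 0" by (simp add: Q_def)
  then have "T \<noteq> {}" by (auto simp: Q_def)
  then have cardT: "card T > 0" using T by (simp add: card_gt_0_iff)
  have N0: "0 \<le> N u" for u unfolding N_def by (intro sum_nonneg) auto
  have Nge: "(u a)\<^sup>2 \<le> N u" if "a \<in> T" for a u
    unfolding N_def using T that by (intro member_le_sum) auto
  define S where "S = {m. 0 \<le> m \<and> (\<forall>u. - m * N u \<le> Q u)}"
  \<comment> \<open>A crude bound which shows that the set \<open>S\<close> of admissible shifts is
    nonempty.\<close>
  define M where "M = (\<Sum>a\<in>T. \<Sum>b\<in>T. \<bar>B a b\<bar>)"
  have "- M * N u \<le> Q u" for u
  proof -
    have "- (\<bar>B a b\<bar> * N u) \<le> B a b * u a * u b" if "a \<in> T" "b \<in> T" for a b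
    proof -
      have "0 \<le> (\<bar>u a\<bar> - \<bar>u b\<bar>)\<^sup>2" by simp
      then have "2 * \<bar>u a * u b\<bar> \<le> (u a)\<^sup>2 + (u b)\<^sup>2"
        by (simp add: power2_diff abs_mult)
      then have "\<bar>u a * u b\<bar> \<le> N u" using Nge[OF that(1), of u] Nge[OF that(2), of u] by linarith
      then have "\<bar>B a b * u a * u b\<bar> \<le> \<bar>B a b\<bar> * N u"
        by (simp add: abs_mult mult.assoc mult_left_mono)
      then show ?thesis by linarith
    qed
    then have "(\<Sum>a\<in>T. \<Sum>b\<in>T. - (\<bar>B a b\<bar> * N u)) \<le> Q u"
      unfolding Q_def by (intro sum_mono) auto
    then show ?thesis by (simp add: M_def sum_negf sum_distrib_right)
  qed
  moreover have "0 \<le> M" unfolding M_def by (intro sum_nonneg) auto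
  ultimately have "M \<in> S" by (simp add: S_def)
  have bdd: "bdd_below S" by (rule bdd_belowI[of _ 0]) (simp add: S_def)
  define \<mu> where "\<mu> = Inf S"
  have \<mu>: "- \<mu> * N u \<le> Q u" for u
  proof (cases "N u = 0")
    case True
    then show ?thesis using \<open>M \<in> S\<close> by (auto simp: S_def) (metis mult_zero_right neg_0_equal_iff_equal)
  next
    case False
    then have pos: "N u > 0" using N0[of u] by simp
    have "- Q u / N u \<le> m" if "m \<in> S" for m
    proof -
      have "- (m * N u) \<le> Q u" using that by (auto simp: S_def)
      then show ?thesis by (subst pos_divide_le_eq[OF pos]) linarith
    qed
    then have "- Q u / N u \<le> \<mu>"
      unfolding \<mu>_def using \<open>M \<in> S\<close> by (intro cInf_greatest) auto
    then have "- Q u \<le> \<mu> * N u" by (subst (asm) pos_divide_le_eq[OF pos])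
    then show ?thesis by simp
  qed
  have "0 \<le> \<mu>" unfolding \<mu>_def using \<open>M \<in> S\<close> by (intro cInf_greatest) (auto simp: S_def)
  moreover have "\<mu> \<noteq> 0" using \<mu>[of u] neg by auto
  ultimately have mpos: "0 < \<mu>" by simp
  \<comment> \<open>A \<open>w\<close> violating the shift \<open>\<nu>\<close> has
    \<open>R w < \<mu> / card T * N w\<close>; the factor \<open>card T\<close> is what may be lost
    in passing from \<open>N w\<close> to its largest summand.\<close>
  define \<nu> where "\<nu> = \<mu> * (1 - 1 / card T)"
  have "\<nu> < \<mu>" using mpos cardT by (simp add: \<nu>_def algebra_simps)
  moreover have "0 \<le> \<nu>" using mpos cardT by (simp add: \<nu>_def)
  ultimately have "\<nu> \<notin> S" using cInf_lower[OF _ bdd, of \<nu>] by (auto simp: \<mu>_def)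
  then obtain w where w: "Q w < - \<nu> * N w" using \<open>0 \<le> \<nu>\<close> by (auto simp: S_def not_le)
  define R where "R u = Q u + \<mu> * N u" for u
  have R0: "0 \<le> R u" for u using \<mu>[of u] by (simp add: R_def)
  have R_form: "R u = (\<Sum>a\<in>T. \<Sum>b\<in>T. (B a b + (if a = b then \<mu> else 0)) * u a * u b)" for u
    unfolding R_def Q_def N_def using T
    by (simp add: distrib_right sum.distrib if_distrib[of "\<lambda>x. x * _"] sum_distrib_left power2_eq_square mult.assoc
        cong: if_cong)
  have Rw: "R w < \<mu> / card T * N w"
    using w by (simp add: R_def \<nu>_def algebra_simps)
  have "Max ((\<lambda>a. (w a)\<^sup>2) ` T) \<in> (\<lambda>a. (w a)\<^sup>2) ` T" using T \<open>T \<noteq> {}\<close> by (intro Max_in) auto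
  then obtain t where t1: "t \<in> T" and "Max ((\<lambda>a. (w a)\<^sup>2) ` T) = (w t)\<^sup>2" by (elim imageE)
  then have t2: "(w a)\<^sup>2 \<le> (w t)\<^sup>2" if "a \<in> T" for a
    using Max_ge[of "(\<lambda>a. (w a)\<^sup>2) ` T" "(w a)\<^sup>2"] T that by simp
  note t = t1 t2
  have "N w \<le> card T * (w t)\<^sup>2"
    unfolding N_def using sum_bounded_above[of T "\<lambda>a. (w a)\<^sup>2" "(w t)\<^sup>2"] t(2) by simp
  then have "\<mu> / card T * N w \<le> \<mu> / card T * (card T * (w t)\<^sup>2)"
    using mpos by (intro mult_left_mono) auto
  then have Rw': "R w < \<mu> * (w t)\<^sup>2" using Rw cardT by simp
  define z where "z a = (\<Sum>\<sigma>\<in>G t. w (act \<sigma> a))" for a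
  have "R (\<lambda>a. w (act \<sigma> a)) = R w" if \<sigma>: "\<sigma> \<in> G t" for \<sigma>
  proof -
    note b = bij[OF t(1) \<sigma>]
    have "Q w = (\<Sum>a\<in>T. \<Sum>b\<in>T. B (act \<sigma> a) b * w (act \<sigma> a) * w b)"
      unfolding Q_def
      by (rule sum.reindex_bij_betw[OF b, of "\<lambda>a. \<Sum>b\<in>T. B a b * w a * w b", symmetric])
    also have "\<dots> = Q (\<lambda>a. w (act \<sigma> a))"
      unfolding Q_def
    proof (rule sum.cong[OF refl])
      fix a assume "a \<in> T"
      have "(\<Sum>b\<in>T. B (act \<sigma> a) b * w (act \<sigma> a) * w b)
          = (\<Sum>b\<in>T. B (act \<sigma> a) (act \<sigma> b) * w (act \<sigma> a) * w (act \<sigma> b))"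
        by (rule sum.reindex_bij_betw[OF b, of "\<lambda>b. B (act \<sigma> a) b * w (act \<sigma> a) * w b", symmetric])
      then show "(\<Sum>b\<in>T. B (act \<sigma> a) b * w (act \<sigma> a) * w b)
          = (\<Sum>b\<in>T. B a b * w (act \<sigma> a) * w (act \<sigma> b))"
        using inv[OF t(1) \<sigma> \<open>a \<in> T\<close>] by simp
    qed
    finally show ?thesis
      unfolding R_def N_def using sum.reindex_bij_betw[OF b, of "\<lambda>a. (w a)\<^sup>2"] by simp
  qed
  \<comment> \<open>Averaging bounds \<open>R z\<close> by \<open>R w\<close> times the square of
    \<open>card (G t)\<close>, and it multiplies the fixed coordinate \<open>t\<close> by exactly
    \<open>card (G t)\<close>. Hence \<open>R z < \<mu> * N z\<close>.\<close>
  then have "R z \<le> card (G t) * (card (G t) * R w)"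
    using sum_form_average_le[OF R_form R0, where G = "G t" and f = "\<lambda>\<sigma> a. w (act \<sigma> a)"] by (simp add: z_def[abs_def])
  also have "\<dots> < card (G t) * (card (G t) * (\<mu> * (w t)\<^sup>2))"
    using Rw' G[OF t(1)] by (intro mult_strict_left_mono) (auto simp: card_gt_0_iff)
  also have "\<dots> = \<mu> * (z t)\<^sup>2"
    using fixed[OF t(1)] by (simp add: z_def power2_eq_square)
  also have "\<dots> \<le> \<mu> * N z" using Nge[OF t(1)] mpos by (intro mult_left_mono) auto
  finally have "Q z < 0" by (simp add: R_def)
  then show False using avg[OF t(1), of w] by (simp add: Q_def z_def)
qed

section \<open>Moments of the edge variables\<close>

definition ends :: "(nat \<times> nat) set \<Rightarrow> nat set" where
  "ends E = fst ` E \<union> snd ` E"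

lemma card_ends_le: "finite E \<Longrightarrow> card (ends E) \<le> 2 * card E"
  unfolding ends_def using card_Un_le[of "fst ` E" "snd ` E"] card_image_le[of E fst] card_image_le[of E snd]
  by linarith

text \<open>The value of a monomial with support \<open>E\<close> at the complete multipartite graph
  whose parts are the colour classes of \<open>c\<close>.\<close>

definition bichrom :: "(nat \<times> nat) set \<Rightarrow> (nat \<Rightarrow> nat) \<Rightarrow> real" where
  "bichrom E c = of_bool (\<forall>e\<in>E. c (fst e) \<noteq> c (snd e))"

lemma bichrom_Un: "bichrom (A \<union> B) c = bichrom A c * bichrom B c"
  by (auto simp: bichrom_def)

lemma bichrom_empty [simp]: "bichrom {} c = 1"
  by (simp add: bichrom_def)

lemma pattern_local_bichrom: "pattern_local (ends E) (bichrom E)"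
  unfolding pattern_local_def
proof (intro allI impI)
  fix c c' :: "nat \<Rightarrow> nat"
  assume *: "\<forall>i\<in>ends E. \<forall>j\<in>ends E. c i = c j \<longleftrightarrow> c' i = c' j"
  have "c (fst e) = c (snd e) \<longleftrightarrow> c' (fst e) = c' (snd e)" if "e \<in> E" for e
  proof -
    have "fst e \<in> ends E" "snd e \<in> ends E" using that by (auto simp: ends_def)
    then show ?thesis using * by blast
  qed
  then show "bichrom E c = bichrom E c'" by (simp add: bichrom_def)
qed

definition move_edge :: "(nat \<Rightarrow> nat) \<Rightarrow> nat \<times> nat \<Rightarrow> nat \<times> nat" where
  "move_edge \<sigma> e = (min (\<sigma> (fst e)) (\<sigma> (snd e)), max (\<sigma> (fst e)) (\<sigma> (snd e)))"

lemma bichrom_move: "bichrom (move_edge \<sigma> ` E) c = bichrom E (c \<circ> \<sigma>)"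
proof -
  have "c (fst (move_edge \<sigma> e)) \<noteq> c (snd (move_edge \<sigma> e)) \<longleftrightarrow> c (\<sigma> (fst e)) \<noteq> c (\<sigma> (snd e))" for e
    by (auto simp: move_edge_def min_def max_def)
  then show ?thesis by (simp add: bichrom_def)
qed

lemma sum_ordered_pairs:
  fixes f :: "nat \<Rightarrow> nat \<Rightarrow> real"
  assumes "finite V" and sym: "\<And>i j. f i j = f j i"
  shows "(\<Sum>i\<in>V. \<Sum>j\<in>V - {i}. f i j) = 2 * (\<Sum>(i, j)\<in>{(i, j). i \<in> V \<and> j \<in> V \<and> i < j}. f i j)"
proof -
  let ?A = "{(i, j). i \<in> V \<and> j \<in> V \<and> i < j}" and ?B = "{(i, j). i \<in> V \<and> j \<in> V \<and> j < i}"
  have fin: "finite ?A" "finite ?B" by (rule finite_subset[of _ "V \<times> V"]; use assms in auto)+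
  have "(\<Sum>i\<in>V. \<Sum>j\<in>V - {i}. f i j) = (\<Sum>(i, j)\<in>Sigma V (\<lambda>i. V - {i}). f i j)"
    using assms(1) by (intro sum.Sigma) auto
  also have "Sigma V (\<lambda>i. V - {i}) = ?A \<union> ?B" by auto
  also have "(\<Sum>(i, j)\<in>?A \<union> ?B. f i j) = (\<Sum>(i, j)\<in>?A. f i j) + (\<Sum>(i, j)\<in>?B. f i j)"
    using fin by (intro sum.union_disjoint) auto
  also have "(\<Sum>(i, j)\<in>?B. f i j) = (\<Sum>(i, j)\<in>?A. f i j)"
    by (rule sum.reindex_bij_witness[of _ "\<lambda>(i, j). (j, i)" "\<lambda>(i, j). (j, i)"]) (auto simp: sym)
  finally show ?thesis by simp
qed

lemma sum_ordered_triples: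
  fixes f :: "nat \<Rightarrow> nat \<Rightarrow> nat \<Rightarrow> real"
  assumes "finite V" and sym: "\<And>i j l. f i j l = f j i l" "\<And>i j l. f i j l = f i l j"
  shows "(\<Sum>i\<in>V. \<Sum>j\<in>V - {i}. \<Sum>l\<in>V - {i, j}. f i j l)
    = 6 * (\<Sum>(i, j, l)\<in>{(i, j, l). i \<in> V \<and> j \<in> V \<and> l \<in> V \<and> i < j \<and> j < l}. f i j l)"
proof -
  let ?A = "{(i, j, l). i \<in> V \<and> j \<in> V \<and> l \<in> V \<and> i < j \<and> j < l}"
  let ?A1 = "{(i, j, l). i \<in> V \<and> j \<in> V \<and> l \<in> V \<and> i < l \<and> l < j}"
  let ?A2 = "{(i, j, l). i \<in> V \<and> j \<in> V \<and> l \<in> V \<and> j < i \<and> i < l}"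
  let ?A3 = "{(i, j, l). i \<in> V \<and> j \<in> V \<and> l \<in> V \<and> j < l \<and> l < i}"
  let ?A4 = "{(i, j, l). i \<in> V \<and> j \<in> V \<and> l \<in> V \<and> l < i \<and> i < j}"
  let ?A5 = "{(i, j, l). i \<in> V \<and> j \<in> V \<and> l \<in> V \<and> l < j \<and> j < i}"
  let ?f = "\<lambda>(i, j, l). f i j l"
  have fin: "finite ?A" "finite ?A1" "finite ?A2" "finite ?A3" "finite ?A4" "finite ?A5"
    by (rule finite_subset[of _ "V \<times> V \<times> V"]; use assms in auto)+
  have p: "sum ?f ?A1 = sum ?f ?A"
    by (rule sum.reindex_bij_witness[of _ "\<lambda>(i, j, l). (i, l, j)" "\<lambda>(i, j, l). (i, l, j)"]) (auto simp: sym(2))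
  have q: "sum ?f ?A2 = sum ?f ?A"
    by (rule sum.reindex_bij_witness[of _ "\<lambda>(i, j, l). (j, i, l)" "\<lambda>(i, j, l). (j, i, l)"]) (auto simp: sym(1))
  have r: "sum ?f ?A3 = sum ?f ?A1"
    by (rule sum.reindex_bij_witness[of _ "\<lambda>(i, j, l). (j, i, l)" "\<lambda>(i, j, l). (j, i, l)"]) (auto simp: sym(1))
  have t: "sum ?f ?A4 = sum ?f ?A2"
    by (rule sum.reindex_bij_witness[of _ "\<lambda>(i, j, l). (i, l, j)" "\<lambda>(i, j, l). (i, l, j)"]) (auto simp: sym(2))
  have w: "sum ?f ?A5 = sum ?f ?A3"
    by (rule sum.reindex_bij_witness[of _ "\<lambda>(i, j, l). (i, l, j)" "\<lambda>(i, j, l). (i, l, j)"]) (auto simp: sym(2))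
  have "(\<Sum>i\<in>V. \<Sum>j\<in>V - {i}. \<Sum>l\<in>V - {i, j}. f i j l)
      = (\<Sum>i\<in>V. \<Sum>(j, l)\<in>Sigma (V - {i}) (\<lambda>j. V - {i, j}). f i j l)"
    using assms(1) by (intro sum.cong refl sum.Sigma) auto
  also have "\<dots> = sum ?f (Sigma V (\<lambda>i. Sigma (V - {i}) (\<lambda>j. V - {i, j})))"
    using assms(1) by (subst sum.Sigma) (auto intro!: sum.cong)
  also have "Sigma V (\<lambda>i. Sigma (V - {i}) (\<lambda>j. V - {i, j}))
      = ?A \<union> (?A1 \<union> (?A2 \<union> (?A3 \<union> (?A4 \<union> ?A5))))"
    by (auto simp: neq_iff)
  also have "sum ?f \<dots> = sum ?f ?A + (sum ?f ?A1 + (sum ?f ?A2 + (sum ?f ?A3 + (sum ?f ?A4 + sum ?f ?A5))))"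
    using fin by (subst sum.union_disjoint, simp, simp, force)+ simp
  also have "\<dots> = 6 * sum ?f ?A" unfolding w t r q p by simp
  finally show ?thesis .
qed

context fractional_partition
begin

definition edges :: "(nat \<times> nat) set" where
  "edges = {(i, j). i \<in> V \<and> j \<in> V \<and> i < j}"

lemma finite_edges: "finite edges"
  by (rule finite_subset[of _ "V \<times> V"]) (auto simp: edges_def finV)

lemma ends_subset: "E \<subseteq> edges \<Longrightarrow> ends E \<subseteq> V"
  by (auto simp: ends_def edges_def)

definition moment :: "(nat \<times> nat) set \<Rightarrow> real" where
  "moment E = expect V (bichrom E)"

lemma moment_move: "\<sigma> permutes V \<Longrightarrow> moment (move_edge \<sigma> ` E) = moment E"
  unfolding moment_def bichrom_move[abs_def] by (rule expect_permute)

lemma move_edge_inverse: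
  assumes "e \<in> edges" "\<And>x. \<tau> (\<sigma> x) = x"
  shows "move_edge \<tau> (move_edge \<sigma> e) = e"
  using assms by (auto simp: move_edge_def edges_def min_def max_def)

lemma move_edge_edges:
  assumes "\<sigma> permutes V" "e \<in> edges"
  shows "move_edge \<sigma> e \<in> edges"
proof -
  obtain i j where e: "e = (i, j)" "i \<in> V" "j \<in> V" "i < j" using assms(2) by (auto simp: edges_def)
  have "\<sigma> i \<noteq> \<sigma> j" using e(4) inj_eq[OF permutes_inj[OF assms(1)], of i j] by simp
  moreover have "\<sigma> i \<in> V" "\<sigma> j \<in> V" using e(2,3) permutes_in_image[OF assms(1)] by blast+
  ultimately show ?thesis by (simp add: move_edge_def edges_def e(1) min_def max_def)
qed

text \<open>The coordinates of the form are edge sets, and a coordinate \<open>E\<close> is fixed by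
  the permutations of the vertices outside \<open>ends E\<close>. Since \<open>ends E\<close> has at
  most \<open>2 * card E \<le> D\<close> vertices, it can serve as the set \<open>I\<close> of the
  symmetrisation.\<close>

lemma moment_nonneg_form:
  assumes D: "2 * D \<le> card V" "real D \<le> s + 1" "real D \<le> k + 1"
  defines "T \<equiv> {E. E \<subseteq> edges \<and> 2 * card E \<le> D}"
  shows "0 \<le> (\<Sum>A\<in>T. \<Sum>B\<in>T. moment (A \<union> B) * u A * u B)"
proof (rule nonneg_form_by_averaging[where G = "\<lambda>E. {\<sigma>. \<sigma> permutes (V - ends E)}"
      and act = "\<lambda>\<sigma> E. move_edge \<sigma> ` E"])
  show finT: "finite T"
    by (rule finite_subset[of _ "Pow edges"]) (auto simp: T_def finite_edges)
  have T: "ends E \<subseteq> V" "card (ends E) \<le> D" "E \<subseteq> edges" if "E \<in> T" for E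
    using that ends_subset[of E] card_ends_le[of E] finite_subset[OF _ finite_edges, of E]
    by (auto simp: T_def)
  fix E assume E: "E \<in> T"
  show "finite {\<sigma>. \<sigma> permutes (V - ends E)}" using finV by (intro finite_permutations) auto
  show "{\<sigma>. \<sigma> permutes (V - ends E)} \<noteq> {}" using permutes_id by blast
  have inv: "(\<lambda>A. move_edge \<tau> ` (move_edge \<sigma> ` A)) A = A" if "A \<in> T" "\<And>x. \<tau> (\<sigma> x) = x" for A \<sigma> \<tau>
  proof -
    have "move_edge \<tau> (move_edge \<sigma> e) = e" if "e \<in> A" for e
      using T(3)[OF \<open>A \<in> T\<close>] that \<open>\<And>x. \<tau> (\<sigma> x) = x\<close> by (intro move_edge_inverse) auto
    then show ?thesis by (simp add: image_image)
  qed
  have into: "move_edge \<sigma> ` A \<in> T" if "\<sigma> permutes V" "A \<in> T" for \<sigma> A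
  proof -
    have "finite A" using T(3)[OF that(2)] finite_edges finite_subset by blast
    then show ?thesis
      using that card_image_le[of A "move_edge \<sigma>"] move_edge_edges[OF that(1)] unfolding T_def by force
  qed
  have bij: "bij_betw (\<lambda>A. move_edge \<sigma> ` A) T T" if "\<sigma> permutes V" for \<sigma>
    using into[OF that] into[OF permutes_inv[OF that]] inv[of _ "inv \<sigma>" \<sigma>] inv[of _ \<sigma> "inv \<sigma>"] permutes_inverses[OF that]
    by (intro bij_betw_byWitness[where f' = "\<lambda>A. move_edge (inv \<sigma>) ` A"]) auto
  {
    fix \<sigma> assume \<sigma>: "\<sigma> \<in> {\<sigma>. \<sigma> permutes (V - ends E)}"
    then have \<sigma>V: "\<sigma> permutes V" using permutes_outside by blast
    have "move_edge \<sigma> e = e" if "e \<in> E" for e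
    proof -
      have "\<sigma> (fst e) = fst e" "\<sigma> (snd e) = snd e"
        using \<sigma> that by (auto simp: ends_def intro: permutes_not_in)
      then show ?thesis using T(3)[OF E] that by (auto simp: move_edge_def edges_def)
    qed
    then show "move_edge \<sigma> ` E = E" by simp
    show "bij_betw (\<lambda>A. move_edge \<sigma> ` A) T T" by (rule bij[OF \<sigma>V])
    fix A B
    show "moment (move_edge \<sigma> ` A \<union> move_edge \<sigma> ` B) = moment (A \<union> B)"
      unfolding image_Un[symmetric] by (rule moment_move[OF \<sigma>V])
  }
  fix u :: "(nat \<times> nat) set \<Rightarrow> real"
  define z where "z A = (\<Sum>\<sigma>\<in>{\<sigma>. \<sigma> permutes (V - ends E)}. u (move_edge \<sigma> ` A))" for A
  \<comment> \<open>A permutation of the coefficients acts on the function by its inverse; in the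
    sum over the whole group the inverse disappears.\<close>
  have "(\<Sum>A\<in>T. z A * bichrom A c) = symmetrize (ends E) (\<lambda>c. \<Sum>A\<in>T. u A * bichrom A c) c" for c
  proof -
    have "(\<Sum>A\<in>T. z A * bichrom A c)
        = (\<Sum>\<sigma>\<in>{\<sigma>. \<sigma> permutes (V - ends E)}. \<Sum>A\<in>T. u (move_edge \<sigma> ` A) * bichrom A c)"
      unfolding z_def sum_distrib_right by (rule sum.swap)
    also have "\<dots> = (\<Sum>\<sigma>\<in>{\<sigma>. \<sigma> permutes (V - ends E)}. \<Sum>A\<in>T. u A * bichrom A (c \<circ> inv \<sigma>))"
    proof (rule sum.cong[OF refl])
      fix \<sigma> assume "\<sigma> \<in> {\<sigma>. \<sigma> permutes (V - ends E)}"
      then have \<sigma>: "\<sigma> permutes V" using permutes_outside by blast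
      have "bichrom A c = bichrom (move_edge \<sigma> ` A) (c \<circ> inv \<sigma>)" for A
        by (simp add: bichrom_move comp_assoc permutes_inv_o[OF \<sigma>])
      then show "(\<Sum>A\<in>T. u (move_edge \<sigma> ` A) * bichrom A c) = (\<Sum>A\<in>T. u A * bichrom A (c \<circ> inv \<sigma>))"
        using sum.reindex_bij_betw[OF bij[OF \<sigma>], of "\<lambda>A. u A * bichrom A (c \<circ> inv \<sigma>)"] by simp
    qed
    also have "\<dots> = symmetrize (ends E) (\<lambda>c. \<Sum>A\<in>T. u A * bichrom A c) c"
      unfolding symmetrize_def
      by (rule sum_permutations_inverse[symmetric, where f = "\<lambda>\<sigma>. \<Sum>A\<in>T. u A * bichrom A (c \<circ> \<sigma>)"])
    finally show ?thesis .
  qed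
  then have "0 \<le> expect V (\<lambda>c. (\<Sum>A\<in>T. z A * bichrom A c)\<^sup>2)"
    using expect_symmetrize_square_nonneg[OF T(1,2)[OF E] D T(1,2) pattern_local_bichrom, where x = u] by simp
  also have "\<dots> = (\<Sum>A\<in>T. \<Sum>B\<in>T. moment (A \<union> B) * z A * z B)"
  proof -
    have "(\<Sum>A\<in>T. z A * bichrom A c)\<^sup>2 = (\<Sum>A\<in>T. \<Sum>B\<in>T. (z A * z B) * bichrom (A \<union> B) c)" for c
      unfolding power2_eq_square bichrom_Un by (simp add: sum_product mult_ac)
    then show ?thesis
      by (simp add: expect_sum expect_scale moment_def mult_ac)
  qed
  finally show "0 \<le> (\<Sum>A\<in>T. \<Sum>B\<in>T. moment (A \<union> B) * (\<Sum>\<sigma>\<in>{\<sigma>. \<sigma> permutes (V - ends E)}. u (move_edge \<sigma> ` A))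
      * (\<Sum>\<sigma>\<in>{\<sigma>. \<sigma> permutes (V - ends E)}. u (move_edge \<sigma> ` B)))"
    by (simp only: z_def)
qed

section \<open>The edge and triangle equations for the moments\<close>

lemma expect_condexp_pat:
  assumes J: "J \<subseteq> V" "v \<notin> J" and F: "pattern_local (insert v J) F"
    and X: "depends_on K X" "K \<subseteq> V" and small: "card J + card K < card V"
  shows "expect V (\<lambda>c. X c * (\<Sum>u\<in>V - J. F (c(v := c u)))) = expect V (\<lambda>c. X c * condexp_pat J v F c)"
proof -
  have small': "card (J \<union> K) < card V" using small card_Un_le[of J K] by linarith
  have "expect V (\<lambda>c. X c * condexp J v F c) = expect V (\<lambda>c. X c * condexp_pat J v F c)"
    using small J F by (intro expect_cong) (subst condexp_eq_pat, auto simp: PiE_iff)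
  then show ?thesis using expect_condexp[OF J F X small'] by simp
qed

text \<open>Condition on the colour of \<open>i\<close>: the old colour contributes nothing, a new
  one \<open>s * (k - 1)\<close>. The slot \<open>Suc i\<close> only has to differ from
  \<open>i\<close> and may lie outside \<open>V\<close>.\<close>

lemma expect_degree:
  assumes X: "depends_on K X" "K \<subseteq> V" and small: "card K + 1 < card V" and i: "i \<in> V"
  shows "expect V (\<lambda>c. X c * (\<Sum>u\<in>V - {i}. bichrom {(i, u)} c)) = s * (k - 1) * expect V X"
proof -
  define F where "F c = (of_bool (c i \<noteq> c (Suc i)) :: real)" for c :: "nat \<Rightarrow> nat"
  have F: "pattern_local (insert (Suc i) {i}) F" unfolding pattern_local_def F_def by simp
  have "condexp_pat {i} (Suc i) F c = s * (k - 1)" for c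
    using new_colour[of "{i}" c] by (auto simp: condexp_pat_def F_def)
  moreover have "F (c(Suc i := c u)) = bichrom {(i, u)} c" for c u
    by (simp add: F_def bichrom_def)
  ultimately show ?thesis
    using expect_condexp_pat[OF _ _ F X, of] i small by (simp add: mult.commute flip: expect_scale)
qed

text \<open>If \<open>i\<close> and \<open>j\<close> have different colours, only a third colour
  contributes, with weight \<open>s * (k - 2)\<close>; otherwise both sides are 0.\<close>

lemma expect_triangle:
  assumes X: "depends_on K X" "K \<subseteq> V" and small: "card K + 2 < card V" and ij: "i \<in> V" "j \<in> V" "i \<noteq> j"
  shows "expect V (\<lambda>c. X c * (\<Sum>u\<in>V - {i, j}. bichrom {(i, j), (i, u), (j, u)} c))
       = s * (k - 2) * expect V (\<lambda>c. X c * bichrom {(i, j)} c)"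
proof -
  define v where "v = Suc (i + j)"
  have v: "v \<noteq> i" "v \<noteq> j" by (auto simp: v_def)
  define F where "F c = (of_bool (c i \<noteq> c j \<and> c i \<noteq> c v \<and> c j \<noteq> c v) :: real)" for c :: "nat \<Rightarrow> nat"
  have F: "pattern_local (insert v {i, j}) F" unfolding pattern_local_def F_def by simp
  have "condexp_pat {i, j} v F c = s * (k - 2) * bichrom {(i, j)} c" for c
    using new_colour[of "{i, j}" c] ij v by (auto simp: condexp_pat_def F_def bichrom_def)
  moreover have "F (c(v := c u)) = bichrom {(i, j), (i, u), (j, u)} c" for c u
    using v by (auto simp: F_def bichrom_def)
  ultimately show ?thesis
    using expect_condexp_pat[OF _ _ F X, of] ij v small by (simp add: mult_ac flip: expect_scale)
qed

text \<open>Handshake argument: each edge is counted at both ends, and every degree has conditional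
  expectation \<open>s * (k - 1)\<close>. The bound on \<open>ends E\<close> leaves room for the
  vertex conditioned on and one more.\<close>

lemma moment_edge_sum:
  assumes E: "E \<subseteq> edges" and small: "card (ends E) + 1 < card V"
  shows "(\<Sum>e\<in>edges. moment (insert e E)) = real (card V) * (s * (k - 1)) / 2 * moment E"
proof -
  have dep: "depends_on (ends E) (bichrom E)" by (intro pattern_local_imp_depends_on pattern_local_bichrom)
  have "2 * (\<Sum>e\<in>edges. moment (insert e E))
      = expect V (\<lambda>c. bichrom E c * (2 * (\<Sum>(i, j)\<in>edges. bichrom {(i, j)} c)))"
  proof -
    have "moment (insert e E) = expect V (\<lambda>c. bichrom E c * bichrom {e} c)" for e
      unfolding moment_def bichrom_Un[of E "{e}", symmetric] by simp
    then show ?thesis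
      by (simp add: sum_distrib_left case_prod_unfold expect_sum mult.left_commute expect_scale)
  qed
  also have "\<dots> = expect V (\<lambda>c. bichrom E c * (\<Sum>i\<in>V. \<Sum>j\<in>V - {i}. bichrom {(i, j)} c))"
    unfolding edges_def by (subst sum_ordered_pairs[OF finV]) (auto simp: bichrom_def)
  also have "\<dots> = (\<Sum>i\<in>V. expect V (\<lambda>c. bichrom E c * (\<Sum>j\<in>V - {i}. bichrom {(i, j)} c)))"
    by (simp only: sum_distrib_left[of _ _ V] expect_sum)
  also have "\<dots> = (\<Sum>i\<in>V. s * (k - 1) * moment E)"
    unfolding moment_def using dep ends_subset[OF E] small by (intro sum.cong refl expect_degree) auto
  finally show ?thesis by simp
qed

text \<open>Over ordered triples, the sum over the third vertex gives \<open>s * (k - 2)\<close>,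
  the sum over the second \<open>s * (k - 1)\<close>, and the first vertex a factor
  \<open>card V\<close>.\<close>

lemma moment_triangle_sum:
  assumes E: "E \<subseteq> edges" and small: "card (ends E) + 2 < card V"
  shows "(\<Sum>(i, j, l)\<in>{(i, j, l). i \<in> V \<and> j \<in> V \<and> l \<in> V \<and> i < j \<and> j < l}.
      moment (E \<union> {(i, j), (i, l), (j, l)})) = real (card V) * (s * (k - 1)) * (s * (k - 2)) / 6 * moment E"
    (is "sum ?m ?T = _")
proof -
  have dep: "depends_on (ends E) (bichrom E)" by (intro pattern_local_imp_depends_on pattern_local_bichrom)
  let ?t = "\<lambda>(i, j, l). {(i, j), (i, l), (j, l)}"
  have m: "moment (E \<union> A) = expect V (\<lambda>c. bichrom E c * bichrom A c)" for A
    unfolding moment_def bichrom_Un[of E A, symmetric] by simp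
  have "sum ?m ?T = (\<Sum>x\<in>?T. expect V (\<lambda>c. bichrom E c * bichrom (?t x) c))"
    by (intro sum.cong refl) (clarsimp simp only: m prod.case)
  also have "\<dots> = expect V (\<lambda>c. bichrom E c * (\<Sum>x\<in>?T. bichrom (?t x) c))"
    by (simp only: sum_distrib_left expect_sum)
  finally have "6 * sum ?m ?T = expect V (\<lambda>c. 6 * (bichrom E c * (\<Sum>x\<in>?T. bichrom (?t x) c)))"
    by (simp only: expect_scale)
  also have "\<dots> = expect V (\<lambda>c. bichrom E c * (\<Sum>i\<in>V. \<Sum>j\<in>V - {i}. \<Sum>l\<in>V - {i, j}. bichrom {(i, j), (i, l), (j, l)} c))"
  proof (rule expect_cong)
    fix c
    have "(\<Sum>x\<in>?T. bichrom (?t x) c) = (\<Sum>(i, j, l)\<in>?T. bichrom {(i, j), (i, l), (j, l)} c)"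
      by (intro sum.cong refl) auto
    moreover have "(\<Sum>i\<in>V. \<Sum>j\<in>V - {i}. \<Sum>l\<in>V - {i, j}. bichrom {(i, j), (i, l), (j, l)} c)
        = 6 * (\<Sum>(i, j, l)\<in>?T. bichrom {(i, j), (i, l), (j, l)} c)"
      by (rule sum_ordered_triples[OF finV]) (auto simp: bichrom_def)
    ultimately show "6 * (bichrom E c * (\<Sum>x\<in>?T. bichrom (?t x) c)) = bichrom E c *
        (\<Sum>i\<in>V. \<Sum>j\<in>V - {i}. \<Sum>l\<in>V - {i, j}. bichrom {(i, j), (i, l), (j, l)} c)"
      by (simp only: mult.left_commute)
  qed
  also have "\<dots> = (\<Sum>i\<in>V. \<Sum>j\<in>V - {i}. expect V (\<lambda>c. bichrom E c * (\<Sum>l\<in>V - {i, j}. bichrom {(i, j), (i, l), (j, l)} c)))"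
    by (simp only: sum_distrib_left[of _ _ V] sum_distrib_left[of _ _ "V - {_}"] expect_sum)
  also have "\<dots> = (\<Sum>i\<in>V. \<Sum>j\<in>V - {i}. s * (k - 2) * expect V (\<lambda>c. bichrom E c * bichrom {(i, j)} c))"
    using dep ends_subset[OF E] small by (intro sum.cong refl expect_triangle) auto
  also have "\<dots> = s * (k - 2) * (\<Sum>i\<in>V. expect V (\<lambda>c. bichrom E c * (\<Sum>j\<in>V - {i}. bichrom {(i, j)} c)))"
    by (simp add: sum_distrib_left expect_sum)
  also have "(\<Sum>i\<in>V. expect V (\<lambda>c. bichrom E c * (\<Sum>j\<in>V - {i}. bichrom {(i, j)} c)))
      = (\<Sum>i\<in>V. s * (k - 1) * moment E)"
    unfolding moment_def using dep ends_subset[OF E] small by (intro sum.cong refl expect_degree) auto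
  finally have "6 * sum ?m ?T = real (card V) * (s * (k - 1)) * (s * (k - 2)) * moment E"
    by (simp only: sum_constant mult_ac)
  also have "\<dots> = 6 * (real (card V) * (s * (k - 1)) * (s * (k - 2)) / 6 * moment E)" by simp
  finally show ?thesis by (rule mult_left_cancel[THEN iffD1, rotated]) simp
qed

lemma moment_empty_pos: "0 < moment {}"
proof -
  have "expect V (\<lambda>_. 1) = fact (card V - card ({} :: nat set)) * expect {} (\<lambda>_. 1)"
    by (rule expect_marginal) (auto simp: depends_on_def)
  moreover have "expect {} (\<lambda>_. 1) = 1"
    by (simp add: expect_def weight_def occ_def)
  moreover have "bichrom {} = (\<lambda>_. 1)" by (simp add: fun_eq_iff)
  ultimately show ?thesis by (simp add: moment_def)
qed

end

section \<open>Linear functionals and refutations\<close>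

text \<open>Evaluating a monomial by its support alone builds the Boolean equations into the
  functional.\<close>

definition set_functional :: "('v set \<Rightarrow> real) \<Rightarrow> 'v rpoly \<Rightarrow> real" where
  "set_functional l p = (\<Sum>m\<in>Poly_Mapping.keys p. Poly_Mapping.lookup p m * l (Poly_Mapping.keys m))"

lemma set_functional_superset:
  assumes "finite A" "Poly_Mapping.keys p \<subseteq> A"
  shows "set_functional l p = (\<Sum>m\<in>A. Poly_Mapping.lookup p m * l (Poly_Mapping.keys m))"
  unfolding set_functional_def using assms by (intro sum.mono_neutral_left) (auto simp: in_keys_iff)

lemma set_functional_add: "set_functional l (p + q) = set_functional l p + set_functional l q"
proof -
  let ?A = "Poly_Mapping.keys p \<union> Poly_Mapping.keys q"
  have "set_functional l r = (\<Sum>m\<in>?A. Poly_Mapping.lookup r m * l (Poly_Mapping.keys m))"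
    if "r \<in> {p, q, p + q}" for r
    using that keys_add[of p q] by (intro set_functional_superset) auto
  then show ?thesis by (simp add: lookup_add distrib_right sum.distrib)
qed

lemma set_functional_uminus: "set_functional l (- p) = - set_functional l p"
  by (simp add: set_functional_def sum_negf)

lemma set_functional_diff: "set_functional l (p - q) = set_functional l p - set_functional l q"
  using set_functional_add[of l p "- q"] by (simp add: set_functional_uminus)

lemma set_functional_zero [simp]: "set_functional l 0 = 0"
  by (simp add: set_functional_def)

lemma set_functional_sum: "set_functional l (\<Sum>i\<in>A. p i) = (\<Sum>i\<in>A. set_functional l (p i))"
  by (induction A rule: infinite_finite_induct) (simp_all add: set_functional_add)

lemma set_functional_sum_list: "set_functional l (sum_list ps) = sum_list (map (set_functional l) ps)"
  by (induction ps) (simp_all add: set_functional_add)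

lemma set_functional_single: "set_functional l (Poly_Mapping.single m a) = a * l (Poly_Mapping.keys m)"
  by (simp add: set_functional_def)

lemma rpoly_expand: "p = (\<Sum>m\<in>Poly_Mapping.keys p. Poly_Mapping.single m (Poly_Mapping.lookup p m))"
  by (rule poly_mapping_eqI) (simp add: lookup_sum lookup_single when_def in_keys_iff)

lemma keys_add_nat: "Poly_Mapping.keys (a + b) = Poly_Mapping.keys a \<union> Poly_Mapping.keys b"
  for a b :: "'v \<Rightarrow>\<^sub>0 nat"
  by (auto simp: in_keys_iff lookup_add)

lemma set_functional_mult:
  "set_functional l (f * p) = (\<Sum>m\<in>Poly_Mapping.keys f. Poly_Mapping.lookup f m *
     set_functional l (Poly_Mapping.single m 1 * p))"
proof -
  have scale: "set_functional l (Poly_Mapping.single m a * p)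
      = a * set_functional l (Poly_Mapping.single m 1 * p)" for m a
    by (subst (1 2) rpoly_expand[of p])
      (simp add: sum_distrib_left mult_single set_functional_sum set_functional_single mult.assoc)
  have "set_functional l (f * p)
      = (\<Sum>m\<in>Poly_Mapping.keys f. set_functional l (Poly_Mapping.single m (Poly_Mapping.lookup f m) * p))"
    by (subst rpoly_expand[of f]) (simp only: sum_distrib_right set_functional_sum)
  then show ?thesis unfolding scale[of _ "Poly_Mapping.lookup f _"] .
qed

text \<open>The witness \<open>u A\<close> adds up the coefficients of all monomials of
  \<open>g\<close> with support \<open>A\<close>.\<close>

lemma set_functional_square:
  assumes fin: "finite T" and T: "\<And>m. m \<in> Poly_Mapping.keys g \<Longrightarrow> Poly_Mapping.keys m \<in> T"
  shows "\<exists>u. set_functional l (g\<^sup>2) = (\<Sum>A\<in>T. \<Sum>B\<in>T. l (A \<union> B) * u A * u B)"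
proof (intro exI)
  let ?K = "Poly_Mapping.keys g"
  let ?u = "\<lambda>A. \<Sum>m\<in>{m\<in>?K. Poly_Mapping.keys m = A}. Poly_Mapping.lookup g m"
  have group: "(\<Sum>m\<in>?K. Poly_Mapping.lookup g m * \<phi> (Poly_Mapping.keys m)) = (\<Sum>A\<in>T. ?u A * \<phi> A)"
    for \<phi> :: "'a set \<Rightarrow> real"
  proof -
    have "(\<Sum>m\<in>?K. Poly_Mapping.lookup g m * \<phi> (Poly_Mapping.keys m))
        = (\<Sum>A\<in>T. \<Sum>m\<in>{m\<in>?K. Poly_Mapping.keys m = A}. Poly_Mapping.lookup g m * \<phi> (Poly_Mapping.keys m))"
      using fin T by (intro sum.group[symmetric]) auto
    also have "\<dots> = (\<Sum>A\<in>T. ?u A * \<phi> A)"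
      by (intro sum.cong refl) (simp add: sum_distrib_right)
    finally show ?thesis .
  qed
  have "set_functional l (Poly_Mapping.single m 1 * g)
      = (\<Sum>m'\<in>?K. Poly_Mapping.lookup g m' * l (Poly_Mapping.keys m \<union> Poly_Mapping.keys m'))" for m
    by (subst rpoly_expand[of g])
      (simp add: sum_distrib_left mult_single set_functional_sum set_functional_single keys_add_nat)
  then have "set_functional l (g\<^sup>2) = (\<Sum>m\<in>?K. Poly_Mapping.lookup g m *
      (\<Sum>m'\<in>?K. Poly_Mapping.lookup g m' * l (Poly_Mapping.keys m \<union> Poly_Mapping.keys m')))"
    unfolding power2_eq_square set_functional_mult[of l g g] by simp
  also have "\<dots> = (\<Sum>A\<in>T. ?u A * (\<Sum>B\<in>T. ?u B * l (A \<union> B)))"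
    unfolding group[symmetric] ..
  also have "\<dots> = (\<Sum>A\<in>T. \<Sum>B\<in>T. ?u A * (?u B * l (A \<union> B)))"
    by (intro sum.cong refl sum_distrib_left)
  also have "\<dots> = (\<Sum>A\<in>T. \<Sum>B\<in>T. l (A \<union> B) * ?u A * ?u B)"
    by (intro sum.cong refl) (simp only: mult_ac)
  finally show "set_functional l (g\<^sup>2) = (\<Sum>A\<in>T. \<Sum>B\<in>T. l (A \<union> B) * ?u A * ?u B)" .
qed

lemma card_keys_le_mono_degree: "card (Poly_Mapping.keys m) \<le> mono_degree m"
proof -
  have "(\<Sum>v\<in>Poly_Mapping.keys m. 1) \<le> (\<Sum>v\<in>Poly_Mapping.keys m. Poly_Mapping.lookup m v)"
    by (intro sum_mono) (auto simp: in_keys_iff Suc_le_eq)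
  then show ?thesis by (simp add: mono_degree_def)
qed

lemma mono_degree_le_total_degree: "m \<in> Poly_Mapping.keys p \<Longrightarrow> ereal (real (mono_degree m)) \<le> total_degree p"
  unfolding total_degree_def by (rule SUP_upper)

lemma card_keys_le_degree_bound:
  assumes "total_degree f + total_degree p \<le> ereal (real d)"
    and "m \<in> Poly_Mapping.keys f" "m' \<in> Poly_Mapping.keys p"
  shows "card (Poly_Mapping.keys m) + card (Poly_Mapping.keys m') \<le> d"
proof -
  have "ereal (real (mono_degree m)) + ereal (real (mono_degree m')) \<le> total_degree f + total_degree p"
    using assms(2,3) by (intro add_mono mono_degree_le_total_degree)
  also have "\<dots> \<le> ereal (real d)" by (rule assms(1))
  finally have "mono_degree m + mono_degree m' \<le> d" by simp
  then show ?thesis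
    using card_keys_le_mono_degree[of m] card_keys_le_mono_degree[of m'] by linarith
qed

lemma not_sos_refutesI:
  assumes fin: "finite V" and pos: "0 < l {}"
    and ideal: "\<And>f p. p \<in> S \<Longrightarrow> poly_vars f \<subseteq> V \<Longrightarrow> total_degree f + total_degree p \<le> ereal (real d)
      \<Longrightarrow> set_functional l (f * p) = 0"
    and psd: "\<And>u. 0 \<le> (\<Sum>A\<in>{E. E \<subseteq> V \<and> 2 * card E \<le> d}. \<Sum>B\<in>{E. E \<subseteq> V \<and> 2 * card E \<le> d}.
      l (A \<union> B) * u A * u B)"
  shows "\<not> sos_refutes d V S"
proof
  assume "sos_refutes d V S"
  then obtain fs gs where fs: "\<forall>(f, p)\<in>set fs. p \<in> S \<and> poly_vars f \<subseteq> V \<and>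
        total_degree f + total_degree p \<le> ereal (real d)"
    and gs: "\<forall>g\<in>set gs. poly_vars g \<subseteq> V \<and> total_degree g \<le> ereal (real d / 2)"
    and eq: "- 1 = (\<Sum>(f, p)\<leftarrow>fs. f * p) + (\<Sum>g\<leftarrow>gs. g\<^sup>2)"
    unfolding sos_refutes_def by blast
  have "set_functional l (- 1) = - l {}"
    using set_functional_single[of l 0 1] by (simp add: set_functional_uminus)
  moreover have "set_functional l (\<Sum>(f, p)\<leftarrow>fs. f * p) = 0"
  proof -
    have "set_functional l (f * p) = 0" if "(f, p) \<in> set fs" for f p
      using fs that by (intro ideal) auto
    then have "map (set_functional l) (map (\<lambda>(f, p). f * p) fs) = map (\<lambda>_. 0) fs"
      by (auto intro: map_cong)
    then show ?thesis unfolding set_functional_sum_list by (simp only: sum_list_0)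
  qed
  moreover have "0 \<le> set_functional l (\<Sum>g\<leftarrow>gs. g\<^sup>2)"
    unfolding set_functional_sum_list
  proof (rule sum_list_nonneg)
    fix y assume "y \<in> set (map (set_functional l) (map (\<lambda>g. g\<^sup>2) gs))"
    then obtain g where g: "g \<in> set gs" "y = set_functional l (g\<^sup>2)" by auto
    have "\<exists>u. set_functional l (g\<^sup>2) = (\<Sum>A\<in>{E. E \<subseteq> V \<and> 2 * card E \<le> d}. \<Sum>B\<in>{E. E \<subseteq> V \<and> 2 * card E \<le> d}.
      l (A \<union> B) * u A * u B)"
    proof (rule set_functional_square)
      show "finite {E. E \<subseteq> V \<and> 2 * card E \<le> d}"
        by (rule finite_subset[of _ "Pow V"]) (auto simp: fin)
      fix m assume m: "m \<in> Poly_Mapping.keys g"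
      have "ereal (real (mono_degree m)) \<le> ereal (real d / 2)"
        using mono_degree_le_total_degree[OF m] gs g(1) by (meson order_trans)
      then have "2 * mono_degree m \<le> d" by simp
      then have "2 * card (Poly_Mapping.keys m) \<le> d" using card_keys_le_mono_degree[of m] by linarith
      moreover have "Poly_Mapping.keys m \<subseteq> V" using gs g(1) m by (fastforce simp: poly_vars_def)
      ultimately show "Poly_Mapping.keys m \<in> {E. E \<subseteq> V \<and> 2 * card E \<le> d}" by simp
    qed
    then show "0 \<le> y" using psd g(2) by auto
  qed
  ultimately have "- l {} \<ge> 0" by (simp add: eq set_functional_add)
  then show False using pos by simp
qed

section \<open>The equations of \<open>goodman_system\<close> under a functional of supports\<close>

lemma finite_edge_index: "finite (edge_index n)"
  by (rule finite_subset[of _ "{1..n} \<times> {1..n}"]) (auto simp: edge_index_def)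

lemma finite_triangle_index: "finite (triangle_index n)"
  by (rule finite_subset[of _ "{1..n} \<times> {1..n} \<times> {1..n}"]) (auto simp: triangle_index_def)

lemma edge_var_single: "i < j \<Longrightarrow> edge_var i j = Poly_Mapping.single (Poly_Mapping.single (i, j) 1) 1"
  by (simp add: edge_var_def var_poly_def min_def max_def)

lemma set_functional_mult_eq_0:
  assumes "\<And>m. m \<in> Poly_Mapping.keys f \<Longrightarrow> set_functional l (Poly_Mapping.single m 1 * p) = 0"
  shows "set_functional l (f * p) = 0"
  by (subst set_functional_mult) (intro sum.neutral ballI, simp only: assms mult_zero_right)

lemma set_functional_boolean:
  assumes "i < j"
  shows "set_functional l (f * ((edge_var i j)\<^sup>2 - edge_var i j)) = 0"
  by (rule set_functional_mult_eq_0)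
    (simp add: edge_var_single[OF assms] power2_eq_square mult_single right_diff_distrib
      set_functional_diff set_functional_single keys_add_nat)

text \<open>For \<open>n < 2\<close> the left-hand side is constant and may be zero, of degree
  \<open>-\<infinity>\<close>, which leaves the degree of \<open>f\<close> unbounded. Therefore
  \<open>sum\<close> may restrict \<open>card E\<close> only when \<open>2 \<le> n\<close>.\<close>

lemma set_functional_edge_equation:
  assumes sum: "\<And>E. E \<subseteq> edge_index n \<Longrightarrow> (2 \<le> n \<Longrightarrow> card E + 1 \<le> d) \<Longrightarrow>
      (\<Sum>e\<in>edge_index n. l (insert e E)) = r * l E"
    and vars: "poly_vars f \<subseteq> edge_index n"
    and deg: "total_degree f + total_degree ((\<Sum>(i, j)\<in>edge_index n. edge_var i j) - const_poly r) \<le> ereal (real d)"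
      (is "_ + total_degree ?p \<le> _")
  shows "set_functional l (f * ((\<Sum>(i, j)\<in>edge_index n. edge_var i j) - const_poly r)) = 0"
proof (rule set_functional_mult_eq_0)
  have p: "?p = (\<Sum>e\<in>edge_index n. Poly_Mapping.single (Poly_Mapping.single e 1) 1) - Poly_Mapping.single 0 r"
    unfolding const_poly_def by (intro arg_cong2[of _ _ _ _ "(-)"] sum.cong refl)
      (auto simp: edge_index_def edge_var_single)
  fix m assume m: "m \<in> Poly_Mapping.keys f"
  have "card (Poly_Mapping.keys m) + 1 \<le> d" if "2 \<le> n"
  proof -
    have e: "(1, 2) \<in> edge_index n" using that by (auto simp: edge_index_def)
    \<comment> \<open>This monomial shows that the equation has degree at least 1.\<close>
    have "Poly_Mapping.lookup ?p (Poly_Mapping.single (1, 2) 1) = 1"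
    proof -
      have "Poly_Mapping.single e (1 :: nat) = Poly_Mapping.single e' 1 \<longleftrightarrow> e = e'" for e e' :: "nat \<times> nat"
        by (metis keys_single singleton_inject zero_neq_one)
      moreover have "Poly_Mapping.single e (1 :: nat) \<noteq> 0" for e :: "nat \<times> nat"
        by (metis keys_single keys_zero empty_not_insert zero_neq_one)
      ultimately show ?thesis
        unfolding p using e finite_edge_index[of n]
        by (simp add: lookup_minus lookup_sum lookup_single when_def del: One_nat_def)
    qed
    then have "Poly_Mapping.single (1, 2) 1 \<in> Poly_Mapping.keys ?p" by (simp add: in_keys_iff)
    from card_keys_le_degree_bound[OF deg m this] show ?thesis by simp
  qed
  moreover have "Poly_Mapping.keys m \<subseteq> edge_index n" using vars m by (fastforce simp: poly_vars_def)
  ultimately show "set_functional l (Poly_Mapping.single m 1 * ?p) = 0"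
    using sum[of "Poly_Mapping.keys m"] unfolding p
    by (simp add: right_diff_distrib sum_distrib_left mult_single set_functional_diff set_functional_sum
        set_functional_single keys_add_nat)
qed

lemma set_functional_triangle_equation:
  assumes sum: "\<And>E. E \<subseteq> edge_index n \<Longrightarrow> (3 \<le> n \<Longrightarrow> card E + 3 \<le> d) \<Longrightarrow>
      (\<Sum>(i, j, k)\<in>triangle_index n. l (E \<union> {(i, j), (i, k), (j, k)})) = r * l E"
    and vars: "poly_vars f \<subseteq> edge_index n"
    and deg: "total_degree f + total_degree ((\<Sum>(i, j, k)\<in>triangle_index n. edge_var i j * edge_var i k * edge_var j k)
      - const_poly r) \<le> ereal (real d)" (is "_ + total_degree ?p \<le> _")
  shows "set_functional l (f * ((\<Sum>(i, j, k)\<in>triangle_index n. edge_var i j * edge_var i k * edge_var j k)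
      - const_poly r)) = 0"
proof (rule set_functional_mult_eq_0)
  define t where "t = (\<lambda>(i, j, k). Poly_Mapping.single (i, j) 1 + Poly_Mapping.single (i, k) 1
      + Poly_Mapping.single (j, k) 1 :: (nat \<times> nat) \<Rightarrow>\<^sub>0 nat)"
  have p: "?p = (\<Sum>x\<in>triangle_index n. Poly_Mapping.single (t x) 1) - Poly_Mapping.single 0 r"
    unfolding const_poly_def by (intro arg_cong2[of _ _ _ _ "(-)"] sum.cong refl)
      (auto simp: triangle_index_def edge_var_single mult_single t_def)
  have kt: "Poly_Mapping.keys (t (i, j, k)) = {(i, j), (i, k), (j, k)}" for i j k
    by (auto simp: t_def keys_add_nat)
  have kt': "Poly_Mapping.keys (t x) = {(fst x, fst (snd x)), (fst x, snd (snd x)), snd x}" for x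
    using kt[of "fst x" "fst (snd x)" "snd (snd x)"] by simp
  fix m assume m: "m \<in> Poly_Mapping.keys f"
  have "card (Poly_Mapping.keys m) + 3 \<le> d" if "3 \<le> n"
  proof -
    have e: "(1, 2, 3) \<in> triangle_index n" using that by (auto simp: triangle_index_def)
    have "Poly_Mapping.keys (t (1, 2, 3)) \<noteq> Poly_Mapping.keys 0" unfolding kt by simp
    then have "t (1, 2, 3) \<noteq> 0" by metis
    \<comment> \<open>The coefficient counts the triples with this monomial, so it is at least 1
      without an appeal to injectivity of \<open>t\<close>.\<close>
    then have "Poly_Mapping.lookup ?p (t (1, 2, 3)) = (\<Sum>x\<in>triangle_index n. of_bool (t x = t (1, 2, 3)))"
      unfolding p by (simp add: lookup_minus lookup_sum lookup_single when_def of_bool_def)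
    also have "\<dots> \<ge> (of_bool (t (1, 2, 3) = t (1, 2, 3)) :: real)"
      using e finite_triangle_index by (intro member_le_sum) auto
    finally have "t (1, 2, 3) \<in> Poly_Mapping.keys ?p" by (auto simp: in_keys_iff)
    from card_keys_le_degree_bound[OF deg m this] show ?thesis unfolding kt by simp
  qed
  moreover have "Poly_Mapping.keys m \<subseteq> edge_index n" using vars m by (fastforce simp: poly_vars_def)
  ultimately show "set_functional l (Poly_Mapping.single m 1 * ?p) = 0"
    using sum[of "Poly_Mapping.keys m"] unfolding p
    by (simp add: right_diff_distrib sum_distrib_left mult_single set_functional_diff set_functional_sum
        set_functional_single keys_add_nat case_prod_unfold kt' del: Un_insert_right)
qed

lemma goodman_not_refuted:
  assumes pos: "0 < l {}"
    and edge: "\<And>E. E \<subseteq> edge_index n \<Longrightarrow> (2 \<le> n \<Longrightarrow> card E + 1 \<le> d) \<Longrightarrow>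
      (\<Sum>e\<in>edge_index n. l (insert e E)) = \<rho> * real (n choose 2) * l E"
    and triangle: "\<And>E. E \<subseteq> edge_index n \<Longrightarrow> (3 \<le> n \<Longrightarrow> card E + 3 \<le> d) \<Longrightarrow>
      (\<Sum>(i, j, k)\<in>triangle_index n. l (E \<union> {(i, j), (i, k), (j, k)})) = goodman_bound n \<rho> * l E"
    and psd: "\<And>u. 0 \<le> (\<Sum>A\<in>{E. E \<subseteq> edge_index n \<and> 2 * card E \<le> d}. \<Sum>B\<in>{E. E \<subseteq> edge_index n \<and> 2 * card E \<le> d}.
      l (A \<union> B) * u A * u B)"
  shows "\<not> sos_refutes d (edge_index n) (goodman_system n \<rho>)"
proof (rule not_sos_refutesI[where l = l])
  fix f p assume p: "p \<in> goodman_system n \<rho>" and f: "poly_vars f \<subseteq> edge_index n"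
    and deg: "total_degree f + total_degree p \<le> ereal (real d)"
  from p consider (bool) i j where "p = (edge_var i j)\<^sup>2 - edge_var i j" "(i, j) \<in> edge_index n"
    | (edge) "p = (\<Sum>(i, j)\<in>edge_index n. edge_var i j) - const_poly (\<rho> * real (n choose 2))"
    | (tri) "p = (\<Sum>(i, j, l)\<in>triangle_index n. edge_var i j * edge_var i l * edge_var j l)
         - const_poly (goodman_bound n \<rho>)"
    unfolding goodman_system_def by blast
  then show "set_functional l (f * p) = 0"
  proof cases
    case bool
    then show ?thesis using set_functional_boolean[of i j l f] by (simp add: edge_index_def)
  next
    case edge
    show ?thesis using set_functional_edge_equation[OF assms(2) f] deg unfolding edge by blast
  next
    case tri
    show ?thesis using set_functional_triangle_equation[OF triangle f] deg unfolding tri by blast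
  qed
qed (use pos psd finite_edge_index in auto)

section \<open>The generic case and the small cases\<close>

lemma real_choose_2: "real (n choose 2) = real n * (real n - 1) / 2"
  by (simp add: binomial_gbinomial gbinomial_prod_rev numeral_2_eq_2)

lemma real_choose_3: "real (n choose 3) = real n * (real n - 1) * (real n - 2) / 6"
  by (simp add: binomial_gbinomial gbinomial_prod_rev eval_nat_numeral)

text \<open>The functional is evaluation at the graph \<open>Z\<close>, which makes the quadratic
  form a perfect square in every degree.\<close>

lemma not_refuted_of_solution:
  assumes edges: "(\<Sum>e\<in>edge_index n. of_bool (e \<in> Z)) = \<rho> * real (n choose 2)"
    and triangles: "(\<Sum>(i, j, k)\<in>triangle_index n. of_bool ({(i, j), (i, k), (j, k)} \<subseteq> Z)) = goodman_bound n \<rho>"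
  shows "\<not> sos_refutes d (edge_index n) (goodman_system n \<rho>)"
proof (rule goodman_not_refuted[where l = "\<lambda>E. of_bool (E \<subseteq> Z)"])
  fix E :: "(nat \<times> nat) set"
  show "(\<Sum>e\<in>edge_index n. of_bool (insert e E \<subseteq> Z)) = \<rho> * real (n choose 2) * of_bool (E \<subseteq> Z)"
    unfolding edges[symmetric] by (simp add: of_bool_conj sum_distrib_right)
  show "(\<Sum>(i, j, k)\<in>triangle_index n. of_bool (E \<union> {(i, j), (i, k), (j, k)} \<subseteq> Z)) = goodman_bound n \<rho> * of_bool (E \<subseteq> Z)"
    unfolding triangles[symmetric] sum_distrib_right by (intro sum.cong refl) auto
next
  fix u :: "(nat \<times> nat) set \<Rightarrow> real"
  let ?T = "{E. E \<subseteq> edge_index n \<and> 2 * card E \<le> d}"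
  have "(\<Sum>A\<in>?T. \<Sum>B\<in>?T. of_bool (A \<union> B \<subseteq> Z) * u A * u B) = (\<Sum>A\<in>?T. of_bool (A \<subseteq> Z) * u A)\<^sup>2"
    by (simp add: power2_eq_square sum_product of_bool_conj mult_ac)
  then show "0 \<le> (\<Sum>A\<in>?T. \<Sum>B\<in>?T. of_bool (A \<union> B \<subseteq> Z) * u A * u B)" by simp
qed auto

text \<open>For integers \<open>k\<close> and \<open>s\<close> the right-hand sides are the numbers
  of edges and triangles of the complete multipartite graph with \<open>k\<close> parts of size
  \<open>s\<close>.\<close>

lemma goodman_parameters:
  assumes "s * k = real n" "s - 1 = (1 - \<rho>) * (real n - 1)"
  shows "\<rho> * real (n choose 2) = real n * (s * (k - 1)) / 2"
    and "goodman_bound n \<rho> = real n * (s * (k - 1)) * (s * (k - 2)) / 6"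
proof -
  have 1: "s * (k - 1) = \<rho> * (real n - 1)" and 2: "s * (k - 2) = real n - 2 * s"
    using assms by (simp_all add: algebra_simps)
  show "\<rho> * real (n choose 2) = real n * (s * (k - 1)) / 2"
    unfolding 1 real_choose_2 by simp
  have s: "s = 1 + (1 - \<rho>) * (real n - 1)" using assms(2) by simp
  show "goodman_bound n \<rho> = real n * (s * (k - 1)) * (s * (k - 2)) / 6"
    unfolding 1 2 goodman_bound_def real_choose_3 unfolding s by (simp add: divide_simps) (simp add: algebra_simps)
qed

lemma triangle_index_alt:
  "triangle_index n = {(i, j, l). i \<in> {1..n} \<and> j \<in> {1..n} \<and> l \<in> {1..n} \<and> i < j \<and> j < l}"
  by (auto simp: triangle_index_def)

lemma (in fractional_partition) edges_eq_edge_index: "V = {1..n} \<Longrightarrow> edges = edge_index n"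
  unfolding edges_def by (auto simp: edge_index_def)

text \<open>From \<open>card E + 1 \<le> d\<close> and \<open>2 * d \<le> n\<close> it follows that
  \<open>card (ends E) + 1 \<le> 2 * d - 1 < n\<close>, as \<open>moment_edge_sum\<close>
  requires.\<close>

lemma not_refuted_generic:
  assumes prod: "s * k = real n" and s: "s - 1 = (1 - \<rho>) * (real n - 1)"
    and d: "2 * d \<le> n" "real d \<le> s + 1" "real d \<le> k + 1" "2 \<le> d"
  shows "\<not> sos_refutes d (edge_index n) (goodman_system n \<rho>)"
proof -
  interpret fractional_partition "{1..n}" s k using prod by unfold_locales auto
  have ei: "edges = edge_index n" by (rule edges_eq_edge_index) simp
  have small: "card (ends E) \<le> 2 * card E" if "E \<subseteq> edge_index n" for E
    using that finite_subset[OF _ finite_edge_index] by (intro card_ends_le)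
  show ?thesis
  proof (rule goodman_not_refuted[where l = moment])
    show "0 < moment {}" by (rule moment_empty_pos)
  next
    fix E assume E: "E \<subseteq> edge_index n" "2 \<le> n \<Longrightarrow> card E + 1 \<le> d"
    then have "card (ends E) + 1 < card {1..n}" using small[OF E(1)] d by simp
    then show "(\<Sum>e\<in>edge_index n. moment (insert e E)) = \<rho> * real (n choose 2) * moment E"
      using moment_edge_sum[of E] E(1) unfolding ei goodman_parameters(1)[OF prod s] by simp
  next
    fix E assume E: "E \<subseteq> edge_index n" "3 \<le> n \<Longrightarrow> card E + 3 \<le> d"
    then have "card (ends E) + 2 < card {1..n}" using small[OF E(1)] d by simp
    then show "(\<Sum>(i, j, k)\<in>triangle_index n. moment (E \<union> {(i, j), (i, k), (j, k)})) = goodman_bound n \<rho> * moment E"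
      using moment_triangle_sum[of E] E(1) unfolding ei goodman_parameters(2)[OF prod s] triangle_index_alt by simp
  next
    fix u
    show "0 \<le> (\<Sum>A\<in>{E. E \<subseteq> edge_index n \<and> 2 * card E \<le> d}. \<Sum>B\<in>{E. E \<subseteq> edge_index n \<and> 2 * card E \<le> d}.
        moment (A \<union> B) * u A * u B)"
      using moment_nonneg_form[of d u] d unfolding ei by simp
  qed
qed

section \<open>Explicit solutions and functionals for at most four vertices\<close>

lemma edge_index_3: "edge_index 3 = {(1, 2), (1, 3), (2, 3)}"
  by (auto simp: edge_index_def)

lemma edge_index_4: "edge_index 4 = {(1, 2), (1, 3), (1, 4), (2, 3), (2, 4), (3, 4)}"
  by (auto simp: edge_index_def)

lemma triangle_index_4: "triangle_index 4 = {(1, 2, 3), (1, 2, 4), (1, 3, 4), (2, 3, 4)}"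
  by (auto simp: triangle_index_def)

text \<open>The solution is the complete bipartite graph with parts \<open>{1, 2}\<close> and
  \<open>{3, 4}\<close>.\<close>

lemma not_refuted_4: "\<not> sos_refutes d (edge_index 4) (goodman_system 4 (2 / 3))"
proof (rule not_refuted_of_solution[where Z = "{(1, 3), (1, 4), (2, 3), (2, 4)}"])
  show "(\<Sum>e\<in>edge_index 4. of_bool (e \<in> {(1, 3), (1, 4), (2, 3), (2, 4)})) = 2 / 3 * real (4 choose 2)"
    unfolding edge_index_4 real_choose_2 by simp
  show "(\<Sum>(i, j, k)\<in>triangle_index 4. of_bool ({(i, j), (i, k), (j, k)} \<subseteq> {(1, 3), (1, 4), (2, 3), (2, 4)}))
      = goodman_bound 4 (2 / 3)"
    unfolding triangle_index_4 goodman_bound_def real_choose_3 by simp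
qed

lemma not_refuted_1: "\<not> sos_refutes d (edge_index 1) (goodman_system 1 \<rho>)"
proof (rule not_refuted_of_solution[where Z = "{}"])
  have "edge_index 1 = {}" "triangle_index 1 = {}" by (auto simp: edge_index_def triangle_index_def)
  then show "(\<Sum>e\<in>edge_index 1. of_bool (e \<in> {})) = \<rho> * real (1 choose 2)"
    "(\<Sum>(i, j, k)\<in>triangle_index 1. of_bool ({(i, j), (i, k), (j, k)} \<subseteq> {})) = goodman_bound 1 \<rho>"
    unfolding goodman_bound_def real_choose_2 real_choose_3 by simp_all
qed

lemma not_refuted_2:
  assumes "\<rho> = 0 \<or> \<rho> = 1"
  shows "\<not> sos_refutes d (edge_index 2) (goodman_system 2 \<rho>)"
proof (rule not_refuted_of_solution[where Z = "if \<rho> = 0 then {} else {(1, 2)}"])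
  have "edge_index 2 = {(1, 2)}" "triangle_index 2 = {}" by (auto simp: edge_index_def triangle_index_def)
  then show "(\<Sum>e\<in>edge_index 2. of_bool (e \<in> (if \<rho> = 0 then {} else {(1, 2)}))) = \<rho> * real (2 choose 2)"
    "(\<Sum>(i, j, k)\<in>triangle_index 2. of_bool ({(i, j), (i, k), (j, k)} \<subseteq> (if \<rho> = 0 then {} else {(1, 2)})))
      = goodman_bound 2 \<rho>"
    using assms unfolding goodman_bound_def real_choose_2 real_choose_3 by auto
qed

lemma not_refuted_3:
  assumes "0 \<le> \<rho>" "\<rho> \<le> 1"
  shows "\<not> sos_refutes 2 (edge_index 3) (goodman_system 3 \<rho>)"
proof -
  \<comment> \<open>The value \<open>p\<close> on two edges is forced by the edge equation times one
    variable, \<open>\<rho> + 2 p = 3 \<rho>\<^sup>2\<close>. The triangle equation has degree 3,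
    above the bound 2.\<close>
  define l :: "(nat \<times> nat) set \<Rightarrow> real" where
    "l E = (if card E = 0 then 1 else if card E = 1 then \<rho> else \<rho> * (3 * \<rho> - 1) / 2)" for E
  show ?thesis
  proof (rule goodman_not_refuted[where l = l])
    fix E assume E: "E \<subseteq> edge_index 3" "2 \<le> (3 :: nat) \<Longrightarrow> card E + 1 \<le> 2"
    have "finite E" using E(1) finite_edge_index finite_subset by blast
    moreover have "card E = 0 \<or> card E = 1" using E(2) by linarith
    ultimately have "E = {} \<or> (\<exists>e. E = {e})" using card_1_singletonE[of E] by auto
    then consider "E = {}" | "E = {(1, 2)}" | "E = {(1, 3)}" | "E = {(2, 3)}"
      using E(1) unfolding edge_index_3 by blast
    then show "(\<Sum>e\<in>edge_index 3. l (insert e E)) = \<rho> * real (3 choose 2) * l E"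
      unfolding edge_index_3 real_choose_2 by cases (simp_all add: l_def right_diff_distrib)
  next
    fix u :: "(nat \<times> nat) set \<Rightarrow> real"
    let ?T = "{E. E \<subseteq> edge_index 3 \<and> 2 * card E \<le> 2}"
    have "E = {} \<or> (\<exists>e. E = {e})" if "E \<in> ?T" for E
    proof -
      have "finite E" using that finite_edge_index finite_subset by blast
      moreover have "card E = 0 \<or> card E = 1" using that by auto
      ultimately show ?thesis using card_1_singletonE[of E] by auto
    qed
    then have T: "?T = {{}, {(1, 2)}, {(1, 3)}, {(2, 3)}}"
    proof (intro equalityI subsetI)
      fix E assume E: "E \<in> ?T"
      then have "E \<subseteq> {(1, 2), (1, 3), (2, 3)}" unfolding edge_index_3 by blast
      then show "E \<in> {{}, {(1, 2)}, {(1, 3)}, {(2, 3)}}"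
        using \<open>E \<in> ?T \<Longrightarrow> E = {} \<or> (\<exists>e. E = {e})\<close>[OF E] by blast
    qed (auto simp: edge_index_3)
    define a b c where "a = u {(1, 2)}" "b = u {(1, 3)}" "c = u {(2, 3)}"
    \<comment> \<open>Squared mean plus variance: every edge variable has variance
      \<open>\<rho> * (1 - \<rho>)\<close>, and two of them have minus half of it as
      covariance.\<close>
    have "(\<Sum>A\<in>?T. \<Sum>B\<in>?T. l (A \<union> B) * u A * u B)
        = (u {} + \<rho> * (a + b + c))\<^sup>2 + \<rho> * (1 - \<rho>) / 2 * ((a - b)\<^sup>2 + (a - c)\<^sup>2 + (b - c)\<^sup>2)"
      unfolding T by (simp add: l_def a_b_c_def power2_eq_square field_simps)
    also have "\<dots> \<ge> 0" using assms by (intro add_nonneg_nonneg mult_nonneg_nonneg) auto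
    finally show "0 \<le> (\<Sum>A\<in>?T. \<Sum>B\<in>?T. l (A \<union> B) * u A * u B)" .
  qed (auto simp: l_def)
qed

text \<open>
  For \<open>n = 5\<close> and \<open>d = 3\<close>, the edge equation fails for the moments only against a product of two disjoint edge variables.
  Changing the moments of the stars and paths with three edges repairs this, without affecting
  the edge equation against other monomials or the triangle equation.
\<close>

definition small_cubic :: "(nat \<times> nat) set \<Rightarrow> int" where
  "small_cubic E = (if card E = 3 \<and> card (ends E) = 4
     then if \<exists>v\<in>ends E. \<forall>e\<in>E. v = fst e \<or> v = snd e then 2 else - 1 else 0)"

lemma edge_index_5: "edge_index 5 = set [(1, 2), (1, 3), (1, 4), (1, 5), (2, 3), (2, 4), (2, 5), (3, 4), (3, 5), (4, 5)]"
proof -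
  have "edge_index 5 = Set.filter (\<lambda>(i, j). i < j) ({1..5} \<times> {1..5})"
    by (auto simp: edge_index_def)
  also have "\<dots> = set [(1, 2), (1, 3), (1, 4), (1, 5), (2, 3), (2, 4), (2, 5), (3, 4), (3, 5), (4, 5)]"
    by code_simp
  finally show ?thesis .
qed

text \<open>Two edges with a common vertex extend to each of the two other vertices by one star and
  two paths, with total \<open>2 - 1 - 1 = 0\<close>. Two disjoint edges extend to four paths on
  their ends, with total \<open>- 4\<close>. Integer values keep this finite check
  executable.\<close>

lemma small_cubic_sum_pairs:
  "\<forall>a\<in>edge_index 5. \<forall>b\<in>edge_index 5. (\<Sum>e\<in>edge_index 5. small_cubic (insert e {a, b}))
     = (if card (ends {a, b}) = 4 then - 4 else 0)"
  unfolding edge_index_5 by code_simp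

lemma small_cubic_eq_0: "card E \<noteq> 3 \<Longrightarrow> small_cubic E = 0"
  by (simp add: small_cubic_def)

lemma small_cubic_sum:
  assumes E: "E \<subseteq> edge_index 5" "card E \<le> 2"
  shows "(\<Sum>e\<in>edge_index 5. small_cubic (insert e E)) = (if card (ends E) = 4 then - 4 else 0)"
proof (cases "E = {}")
  case True
  then show ?thesis by (simp add: small_cubic_eq_0 ends_def)
next
  case False
  have "finite E" using E(1) finite_edge_index finite_subset by blast
  then have "card E = 1 \<or> card E = 2" using False E(2) card_gt_0_iff[of E] by linarith
  then obtain a b where "E = {a, b}"
    by (metis card_1_singletonE card_2_iff insert_absorb2)
  then show ?thesis using small_cubic_sum_pairs E(1) by simp
qed

lemma small_cubic_triangle:
  "small_cubic {(i, j), (i, k), (j, k)} = 0"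
proof -
  have "ends {(i, j), (i, k), (j, k)} = set [i, j, k]" by (auto simp: ends_def)
  then have "card (ends {(i, j), (i, k), (j, k)}) \<le> 3"
    using card_length[of "[i, j, k]"] by simp
  then show ?thesis by (simp add: small_cubic_def)
qed

context fractional_partition
begin

text \<open>The defect of the edge equation is constant on orbits, so one constant can correct it at
  all disjoint pairs of edges.\<close>

lemma moment_edge_sum_move:
  assumes \<sigma>: "\<sigma> permutes V"
  shows "(\<Sum>e\<in>edges. moment (insert e (move_edge \<sigma> ` E))) = (\<Sum>e\<in>edges. moment (insert e E))"
proof -
  have "(\<Sum>e\<in>edges. moment (insert (move_edge \<sigma> e) (move_edge \<sigma> ` E))) = (\<Sum>e\<in>edges. moment (insert e (move_edge \<sigma> ` E)))"
  proof (rule sum.reindex_bij_betw)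
    show "bij_betw (move_edge \<sigma>) edges edges"
    proof (rule bij_betw_byWitness[where f' = "move_edge (inv \<sigma>)"])
      show "\<forall>e\<in>edges. move_edge (inv \<sigma>) (move_edge \<sigma> e) = e"
        using permutes_inverses[OF \<sigma>] by (intro ballI move_edge_inverse)
      show "\<forall>e\<in>edges. move_edge \<sigma> (move_edge (inv \<sigma>) e) = e"
        using permutes_inverses[OF \<sigma>] by (intro ballI move_edge_inverse)
    qed (use move_edge_edges[OF \<sigma>] move_edge_edges[OF permutes_inv[OF \<sigma>]] in blast)+
  qed
  moreover have "moment (insert (move_edge \<sigma> e) (move_edge \<sigma> ` E)) = moment (insert e E)" for e
    using moment_move[OF \<sigma>, of "insert e E"] by simp
  ultimately show ?thesis by simp
qed

end

text \<open>The disjoint pairs of edges form a single orbit: map 1, 2, 3, 4 to the ends in order and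
  5 to the vertex that is left over.\<close>

lemma matching_5_move:
  assumes E: "E \<subseteq> edge_index 5" "card E \<le> 2" "card (ends E) = 4"
  shows "\<exists>\<sigma>. \<sigma> permutes {1..5} \<and> move_edge \<sigma> ` {(1, 2), (3, 4)} = E"
proof -
  have fin: "finite E" using E(1) finite_edge_index finite_subset by blast
  have "card E = 2" using card_ends_le[OF fin] E(2,3) by simp
  then obtain e f where ef: "E = {e, f}" by (metis card_2_iff)
  obtain a b c d where abcd: "e = (a, b)" "f = (c, d)" by fastforce
  have lt: "a < b" "c < d" and mem: "set [a, b, c, d] \<subseteq> {1..5}"
    using E(1) unfolding ef abcd by (auto simp: edge_index_def)
  have ends: "ends E = set [a, b, c, d]" unfolding ef abcd by (auto simp: ends_def)
  then have "distinct [a, b, c, d]" using E(3) by (intro card_distinct) simp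
  have "card ({1..5} - set [a, b, c, d]) = 1"
    using card_Diff_subset[OF _ mem] E(3) unfolding ends by simp
  then obtain g where "{1..5} - set [a, b, c, d] = {g}" by (rule card_1_singletonE)
  then have "g \<in> {1..5} - set [a, b, c, d]" by (simp only: singletonI)
  then have g: "g \<in> {1..5}" "g \<notin> set [a, b, c, d]" by (blast dest: DiffD1, blast dest: DiffD2)
  define \<sigma> where "\<sigma> x = (if x = 1 then a else if x = 2 then b else if x = 3 then c else if x = 4 then d
    else if x = 5 then g else x)" for x :: nat
  have five: "{1..5} = {1, 2, 3, 4, 5 :: nat}" by auto
  have "\<sigma> permutes {1..5}"
  proof (rule inj_imp_permutes)
    show "inj_on \<sigma> {1..5}"
      unfolding five using \<open>distinct [a, b, c, d]\<close> g(2) by (simp add: inj_on_def \<sigma>_def) auto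
    show "\<sigma> x \<in> {1..5}" if "x \<in> {1..5}" for x
      using mem g(1) that by (simp add: \<sigma>_def)
    show "\<sigma> x = x" if "x \<notin> {1..5}" for x
      using that by (auto simp: \<sigma>_def)
  qed simp
  moreover have "move_edge \<sigma> ` {(1, 2), (3, 4)} = E"
    unfolding ef abcd using lt by (simp add: move_edge_def \<sigma>_def)
  ultimately show ?thesis by blast
qed

lemma not_refuted_5:
  assumes prod: "s * k = 5" and s: "s - 1 = (1 - \<rho>) * 4" and ge: "2 \<le> s" "2 \<le> k"
  shows "\<not> sos_refutes 3 (edge_index 5) (goodman_system 5 \<rho>)"
proof -
  interpret fractional_partition "{1..5}" s k using prod by unfold_locales auto
  have ei: "edges = edge_index 5" by (rule edges_eq_edge_index) simp
  have params: "\<rho> * real (5 choose 2) = real 5 * (s * (k - 1)) / 2"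
    "goodman_bound 5 \<rho> = real 5 * (s * (k - 1)) * (s * (k - 2)) / 6"
    using goodman_parameters[of s k 5 \<rho>] prod s by simp_all
  define w where "w = \<rho> * real (5 choose 2)"
  \<comment> \<open>A quarter of the defect at a disjoint pair, because there
    \<open>small_cubic\<close> sums to \<open>- 4\<close>.\<close>
  define r where "r = ((\<Sum>e\<in>edge_index 5. moment (insert e {(1, 2), (3, 4)})) - w * moment {(1, 2), (3, 4)}) / 4"
  define l where "l E = moment E + r * of_int (small_cubic E)" for E
  show ?thesis
  proof (rule goodman_not_refuted[where l = l])
    show "0 < l {}" using moment_empty_pos by (simp add: l_def small_cubic_eq_0)
  next
    fix E assume E: "E \<subseteq> edge_index 5" "2 \<le> (5 :: nat) \<Longrightarrow> card E + 1 \<le> 3"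
    then have c2: "card E \<le> 2" by simp
    have fin: "finite E" using E(1) finite_edge_index finite_subset by blast
    have l: "(\<Sum>e\<in>edge_index 5. l (insert e E)) = (\<Sum>e\<in>edge_index 5. moment (insert e E))
        + r * (if card (ends E) = 4 then - 4 else 0)"
      using arg_cong[OF small_cubic_sum[OF E(1) c2], of real_of_int]
      by (simp add: l_def sum.distrib sum_distrib_left[symmetric] of_int_sum)
    have lE: "l E = moment E" using c2 by (simp add: l_def small_cubic_eq_0)
    show "(\<Sum>e\<in>edge_index 5. l (insert e E)) = \<rho> * real (5 choose 2) * l E"
    proof (cases "card (ends E) = 4")
      case True
      then obtain \<sigma> where \<sigma>: "\<sigma> permutes {1..5}" "E = move_edge \<sigma> ` {(1, 2), (3, 4)}"
        using matching_5_move[OF E(1) c2] by blast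
      show ?thesis
        unfolding l lE using True moment_edge_sum_move[OF \<sigma>(1), of "{(1, 2), (3, 4)}"]
          moment_move[OF \<sigma>(1), of "{(1, 2), (3, 4)}"]
        unfolding \<sigma>(2)[symmetric] ei by (simp add: r_def w_def diff_divide_distrib)
    next
      case False
      then have "card (ends E) + 1 < card {1..5 :: nat}" using card_ends_le[OF fin] c2 by simp
      then show ?thesis
        using moment_edge_sum[of E] E(1) False unfolding l lE ei params by simp
    qed
  next
    fix E assume E: "E \<subseteq> edge_index 5" "3 \<le> (5 :: nat) \<Longrightarrow> card E + 3 \<le> 3"
    have "finite E" using E(1) finite_edge_index finite_subset by blast
    then have E0: "E = {}" using E(2) by simp
    have "(\<Sum>(i, j, k)\<in>triangle_index 5. l (E \<union> {(i, j), (i, k), (j, k)}))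
        = (\<Sum>(i, j, k)\<in>triangle_index 5. moment ({} \<union> {(i, j), (i, k), (j, k)}))"
      unfolding E0 l_def Un_empty_left small_cubic_triangle by simp
    also have "\<dots> = goodman_bound 5 \<rho> * moment {}"
      using moment_triangle_sum[of "{}"] unfolding params triangle_index_alt by (simp add: ends_def)
    also have "\<dots> = goodman_bound 5 \<rho> * l E" by (simp add: E0 l_def small_cubic_eq_0)
    finally show "(\<Sum>(i, j, k)\<in>triangle_index 5. l (E \<union> {(i, j), (i, k), (j, k)})) = goodman_bound 5 \<rho> * l E" .
  next
    fix u :: "(nat \<times> nat) set \<Rightarrow> real"
    \<comment> \<open>At most one edge satisfies \<open>2 * card E \<le> 3\<close>, so the form only
      sees unions of at most two edges. There the correction vanishes, and positivity is available
      with \<open>D = 2\<close>, as \<open>2 * 2 \<le> 5\<close>.\<close>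
    have T: "{E. E \<subseteq> edge_index 5 \<and> 2 * card E \<le> 3} = {E. E \<subseteq> edges \<and> 2 * card E \<le> 2}"
      unfolding ei by (intro Collect_cong conj_cong refl) presburger
    have "l (A \<union> B) = moment (A \<union> B)"
      if "A \<in> {E. E \<subseteq> edge_index 5 \<and> 2 * card E \<le> 3}" "B \<in> {E. E \<subseteq> edge_index 5 \<and> 2 * card E \<le> 3}" for A B
    proof -
      have "2 * card A \<le> 3" "2 * card B \<le> 3" using that by auto
      then have "card (A \<union> B) \<le> 2" using card_Un_le[of A B] by presburger
      then show ?thesis by (simp add: l_def small_cubic_eq_0)
    qed
    then have "(\<Sum>A\<in>{E. E \<subseteq> edge_index 5 \<and> 2 * card E \<le> 3}. \<Sum>B\<in>{E. E \<subseteq> edge_index 5 \<and> 2 * card E \<le> 3}.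
        l (A \<union> B) * u A * u B) = (\<Sum>A\<in>{E. E \<subseteq> edge_index 5 \<and> 2 * card E \<le> 3}.
        \<Sum>B\<in>{E. E \<subseteq> edge_index 5 \<and> 2 * card E \<le> 3}. moment (A \<union> B) * u A * u B)"
      by (intro sum.cong refl) simp
    also have "\<dots> \<ge> 0"
      unfolding T using ge by (intro moment_nonneg_form) auto
    finally show "0 \<le> (\<Sum>A\<in>{E. E \<subseteq> edge_index 5 \<and> 2 * card E \<le> 3}. \<Sum>B\<in>{E. E \<subseteq> edge_index 5 \<and> 2 * card E \<le> 3}.
        l (A \<union> B) * u A * u B)" .
  qed
qed

text \<open>The hypothesis on \<open>n = 2\<close> excludes exactly the values of
  \<open>\<rho>\<close> for which \<open>sos_refutes_single_edge\<close> constructs a refutation.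
  Since \<open>m * m \<le> s * k = n\<close>, the generic bound \<open>2 * (m + 1) \<le> n\<close>
  can fail only for \<open>m \<le> 2\<close>, hence for \<open>n \<le> 5\<close>.\<close>

theorem mainTheorem2:
  fixes n :: nat and \<rho> k :: real
  assumes n_pos: "n \<ge> 1"
    and rho_range: "0 \<le> \<rho>" "\<rho> \<le> 1"
    and k_def: "real n / k - 1 = (1 - \<rho>) * (real n - 1)"
    and not_single_edge: "n = 2 \<Longrightarrow> \<rho> = 0 \<or> \<rho> = 1"
  shows "\<not> sos_refutes (nat \<lfloor>min k (real n / k)\<rfloor> + 1) (edge_index n) (goodman_system n \<rho>)"
proof -
  define s where "s = real n / k"
  define m where "m = nat \<lfloor>min k s\<rfloor>"
  have s: "s - 1 = (1 - \<rho>) * (real n - 1)" using k_def by (simp add: s_def)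
  have "0 \<le> (1 - \<rho>) * (real n - 1)" using n_pos rho_range by (intro mult_nonneg_nonneg) auto
  then have s1: "1 \<le> s" using s by linarith
  \<comment> \<open>For \<open>k = 0\<close> the quotient \<open>s\<close> would be 0 by convention,
    against \<open>1 \<le> s\<close>.\<close>
  then have k0: "0 < k" by (cases "k = 0") (auto simp: s_def zero_less_divide_iff dest: less_le_trans[OF zero_less_one])
  then have sk: "s * k = real n" by (simp add: s_def)
  have "(1 - \<rho>) * (real n - 1) \<le> 1 * (real n - 1)"
    using n_pos rho_range by (intro mult_right_mono) auto
  then have "s - 1 \<le> real n - 1" unfolding s by (simp only: mult_1)
  then have "s \<le> s * k" unfolding sk by simp
  then have k1: "1 \<le> k" using s1 by simp
  have m1: "1 \<le> m" using s1 k1 by (simp add: m_def le_nat_iff le_floor_iff)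
  have mk: "real m \<le> k" "real m \<le> s"
    using s1 k1 of_int_floor_le[of "min k s"] by (auto simp: m_def)
  have mm: "m * m \<le> n"
  proof -
    have "real m * real m \<le> s * k" using mk s1 by (intro mult_mono) auto
    then show ?thesis unfolding sk by (metis of_nat_le_iff of_nat_mult)
  qed
  have "\<not> sos_refutes (m + 1) (edge_index n) (goodman_system n \<rho>)"
  proof (cases "2 * (m + 1) \<le> n")
    case True
    then show ?thesis using mk m1 by (intro not_refuted_generic[OF sk s]) auto
  next
    case False
    have "m \<le> 2"
    proof (rule ccontr)
      assume "\<not> m \<le> 2"
      then have "3 * m \<le> m * m" by simp
      then have "3 * m \<le> n" using mm by (rule order_trans)
      then show False using False \<open>\<not> m \<le> 2\<close> by presburger
    qed
    then have m12: "m = 1 \<or> m = 2" using m1 by linarith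
    then have "n = 1 \<or> n = 2 \<or> n = 3 \<and> m = 1 \<or> n = 4 \<and> m = 2 \<or> n = 5 \<and> m = 2"
    proof
      assume m: "m = 1"
      then have "1 \<le> n" "n < 4" using False n_pos by simp_all
      then show ?thesis using m by presburger
    next
      assume m: "m = 2"
      then have "4 \<le> n" "n < 6" using False mm by simp_all
      then show ?thesis using m by presburger
    qed
    then consider "n = 1" | "n = 2" | "n = 3" "m = 1" | "n = 4" "m = 2" | "n = 5" "m = 2"
      by blast
    then show ?thesis
    proof cases
      case 1
      then show ?thesis using not_refuted_1[of "m + 1" \<rho>] by simp
    next
      case 2
      then show ?thesis using not_refuted_2[of \<rho> "m + 1"] not_single_edge by simp
    next
      case 3
      then show ?thesis using not_refuted_3[OF rho_range] by (simp add: numeral_2_eq_2)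
    next
      case 4
      \<comment> \<open>With \<open>s * k = 4\<close> this says \<open>s + k \<le> 4\<close>, while
        both numbers are at least 2.\<close>
      have "0 \<le> (s - 2) * (k - 2)" using mk 4 by (intro mult_nonneg_nonneg) auto
      then have "2 * s + 2 * k \<le> 8" using sk 4 by (simp add: algebra_simps)
      then have "s = 2" using mk 4 by simp
      then have "\<rho> = 2 / 3" using s 4 by (simp add: field_simps)
      show ?thesis unfolding 4(1) \<open>\<rho> = 2 / 3\<close> by (rule not_refuted_4)
    next
      case 5
      then show ?thesis using not_refuted_5[of s k \<rho>] sk s mk by simp
    qed
  qed
  then show ?thesis by (simp add: m_def s_def)
qed

end
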